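(* Let $N,M$ be integers with $0<M<N/2$. Then the geometric realization $B\mathbf{Str}(N,M)$ of the poset $\mathbf{Str}(N,M)$ is homotopy equivalent to the circle $S^1$.
   Context: A circular symbol string of length $N$ is $s=s_1\cdots s_N$ with each $s_i\in\{0,1,X\}$, indices read cyclically modulo $N$; $0,1$ are called bits. A block of $s$ is a maximal cyclic run of consecutive equal symbols. $s$ is a circular cellular string of rank $M$ if it has exactly $M$ blocks of symbol $0$, exactly $M$ blocks of symbol $1$, and every block of symbol $X$ is cyclically preceded and followed by blocks of different bits (one of symbol $0$ and one of symbol $1$). Its dimension is its number of symbols $X$. $\mathbf{Str}(N,M)$ is the set of such strings, partially ordered by $s'<s$ iff $s$ is obtained from $s'$ by replacing some (at least one) of the bits of $s'$ by $X$. The geometric realization $B$ of a poset is the geometric realization of its order complex. *)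

theory Defs
  imports "HOL-Analysis.Analysis"
begin

text \<open>Symbols: the bits 0 (S0), 1 (S1) and the symbol X (SX).
  A circular string of length N is a list of length N, read cyclically.\<close>

datatype sym = S0 | S1 | SX

definition is_bit :: "sym \<Rightarrow> bool" where
  "is_bit c \<longleftrightarrow> c \<noteq> SX"

definition cyc :: "sym list \<Rightarrow> nat \<Rightarrow> sym" where
  "cyc s i = s ! (i mod length s)"

text \<open>Number of blocks (maximal cyclic runs) of symbol c.  If the whole string
  consists of c it is a single block; otherwise count positions where a block of c starts.\<close>
definition num_blocks :: "sym list \<Rightarrow> sym \<Rightarrow> nat" where
  "num_blocks s c =
     (if s \<noteq> [] \<and> (\<forall>i<length s. s ! i = c) then 1
      else card {i. i < length s \<and> s ! i = c \<and> cyc s (i + length s - 1) \<noteq> c})"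

definition X_blocks_ok :: "sym list \<Rightarrow> bool" where
  "X_blocks_ok s \<longleftrightarrow>
     (\<forall>i<length s. \<forall>d<length s.
        ((\<forall>k\<le>d. cyc s (i + k) = SX) \<and>
         cyc s (i + length s - 1) \<noteq> SX \<and> cyc s (i + d + 1) \<noteq> SX)
        \<longrightarrow> (is_bit (cyc s (i + length s - 1)) \<and> is_bit (cyc s (i + d + 1)) \<and>
             cyc s (i + length s - 1) \<noteq> cyc s (i + d + 1)))
     \<and> \<not> (s \<noteq> [] \<and> (\<forall>i<length s. s ! i = SX))"

definition Str :: "nat \<Rightarrow> nat \<Rightarrow> sym list set" where
  "Str N M = {s. length s = N \<and> num_blocks s S0 = M \<and> num_blocks s S1 = M \<and> X_blocks_ok s}"

definition str_le :: "sym list \<Rightarrow> sym list \<Rightarrow> bool" where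
  "str_le s' s \<longleftrightarrow> length s' = length s \<and>
     (\<forall>i<length s. s' ! i = s ! i \<or> (s ! i = SX \<and> is_bit (s' ! i)))"

definition str_less :: "sym list \<Rightarrow> sym list \<Rightarrow> bool" where
  "str_less s' s \<longleftrightarrow> str_le s' s \<and> s' \<noteq> s"

text \<open>Geometric realization of the order complex of a finite poset (P, le):
  the points are the convex combinations (barycentric coordinates) supported on a chain,
  topologized as a subspace of the product space \<real>^P (equivalently Euclidean space,
  since P is finite and supports lie in P).\<close>
definition is_chain :: "('a \<Rightarrow> 'a \<Rightarrow> bool) \<Rightarrow> 'a set \<Rightarrow> bool" where
  "is_chain le C \<longleftrightarrow> (\<forall>x\<in>C. \<forall>y\<in>C. le x y \<or> le y x)"

definition order_complex_realization :: "'a set \<Rightarrow> ('a \<Rightarrow> 'a \<Rightarrow> bool) \<Rightarrow> ('a \<Rightarrow> real) set" where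
  "order_complex_realization P le =
     {f. (\<forall>x. 0 \<le> f x) \<and> {x. f x \<noteq> 0} \<subseteq> P \<and> is_chain le {x. f x \<noteq> 0} \<and> sum f P = 1}"

definition geom_realization :: "'a set \<Rightarrow> ('a \<Rightarrow> 'a \<Rightarrow> bool) \<Rightarrow> ('a \<Rightarrow> real) topology" where
  "geom_realization P le = subtopology (powertop_real UNIV) (order_complex_realization P le)"

end

theory Submission
  imports Defs
begin

text \<open>Unrolled along the universal cover of the circle, a cellular string becomes a pair of integer
  height functions \<open>l \<le> u\<close> that are nondecreasing, satisfy \<open>u (i + 1) \<le> l i + 1\<close> and grow by \<open>2M\<close>
  over a period; the pair is unique up to an even constant, and the order of strings is inclusion of
  the intervals \<open>[l i, u i]\<close>. The same conditions on real height functions are convex. A point of the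
  realization is the law of a random element of a chain, with a parameter \<open>t\<close> uniform in \<open>[0,1)\<close>. One
  interpolates its heights linearly to the straight lines \<open>a + 2Mi/N \<plusminus> ct\<close>, where \<open>a\<close> is the mean
  height at position 0, and rounds back to integers. Since \<open>2M/N < 1\<close> there is room for some \<open>c > 0\<close>,
  and the term \<open>ct\<close> makes the law of the rounded string depend continuously on all data. This is a
  homotopy from the identity to a map that factors through the circle of values of \<open>a\<close> modulo 2. Conversely the
  loop of rounded lines has mean height within distance 1 of \<open>a\<close>, so the composite on the circle has
  no antipodal value and is homotopic to the identity.\<close>

section \<open>Realizations of finite posets as laws of random chain elements\<close>

text \<open>Induction keeps the larger of two comparable elements. The relation is a parameter
  because the converse order is used too, to find least elements.\<close>

lemma finite_total_greatest:
  assumes "finite C" "C \<noteq> {}" and total: "\<And>x y. x \<in> C \<Longrightarrow> y \<in> C \<Longrightarrow> le x y \<or> le y x"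
    and trans: "\<And>x y z. le x y \<Longrightarrow> le y z \<Longrightarrow> le x z"
  shows "\<exists>g\<in>C. \<forall>x\<in>C. le x g"
  using assms(1,2) total
proof (induction C rule: finite_ne_induct)
  case (singleton x)
  then show ?case by blast
next
  case (insert x F)
  have "\<exists>g\<in>F. \<forall>y\<in>F. le y g"
    by (rule insert.IH) (use insert.prems in blast)
  then obtain g where g: "g \<in> F" "\<forall>y\<in>F. le y g" by blast
  show ?case
  proof (cases "le x g")
    case True
    then show ?thesis using g by blast
  next
    case False
    then have "le g x" using insert.prems[of x g] g(1) by blast
    moreover have "le x x" using insert.prems[of x x] by blast
    ultimately show ?thesis using g trans by blast
  qed
qed

locale finite_poset =
  fixes P :: "'a set" and le :: "'a \<Rightarrow> 'a \<Rightarrow> bool"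
  assumes finite_P: "finite P"
    and le_refl: "le x x"
    and le_trans: "le x y \<Longrightarrow> le y z \<Longrightarrow> le x z"
    and le_antisym: "le x y \<Longrightarrow> le y x \<Longrightarrow> x = y"
begin

abbreviation R :: "('a \<Rightarrow> real) set" where
  "R \<equiv> order_complex_realization P le"

section \<open>Laws of rising families in a finite poset\<close>

definition rising :: "(real \<Rightarrow> 'a) \<Rightarrow> bool" where
  "rising S \<longleftrightarrow> (\<forall>t\<in>{0..<1}. S t \<in> P) \<and> (\<forall>t\<in>{0..<1}. \<forall>t'\<in>{0..<1}. t \<le> t' \<longrightarrow> le (S t) (S t'))"

definition law :: "(real \<Rightarrow> 'a) \<Rightarrow> 'a \<Rightarrow> real" where
  "law S x = measure lborel {t\<in>{0..<1}. S t = x}"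

lemma law_cong: "(\<And>t. t \<in> {0..<1} \<Longrightarrow> S t = S' t) \<Longrightarrow> law S = law S'"
  unfolding law_def by (intro ext arg_cong[where f = "measure lborel"]) auto

text \<open>By antisymmetry a value taken at two times is taken throughout between them, so level
  sets are intervals.\<close>

lemma rising_level_borel:
  assumes "rising S"
  shows "{t\<in>{0..<1}. S t = x} \<in> sets borel"
proof (rule real_interval_borel_measurable)
  show "is_interval {t\<in>{0..<1}. S t = x}"
    unfolding is_interval_1
  proof (intro ballI allI impI)
    fix a b c
    assume a: "a \<in> {t \<in> {0..<1}. S t = x}" and b: "b \<in> {t \<in> {0..<1}. S t = x}"
      and c: "a \<le> c \<and> c \<le> b"
    then have "a \<in> {0..<1}" "b \<in> {0..<1}" "c \<in> {0..<1}" by auto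
    then have "le (S a) (S c)" "le (S c) (S b)"
      using assms c unfolding rising_def by blast+
    then have "S c = x" using a b le_antisym by auto
    then show "c \<in> {t \<in> {0..<1}. S t = x}" using a b c by auto
  qed
qed

lemma law_pos_attained:
  assumes "law S x \<noteq> 0"
  shows "\<exists>t\<in>{0..<1}. S t = x"
proof (rule ccontr)
  assume "\<not> ?thesis"
  then have "{t\<in>{0..<1}. S t = x} = {}" by auto
  then show False using assms unfolding law_def by (metis measure_empty)
qed

text \<open>The level sets partition \<open>[0,1)\<close>, which gives total weight 1; elements of
  nonzero weight are attained, and attained values are comparable.\<close>

lemma law_in_realization:
  assumes "rising S"
  shows "law S \<in> R"
proof -
  have "sum (law S) P = 1"
  proof -
    have "measure lborel (\<Union>x\<in>P. {t\<in>{0..<1::real}. S t = x}) = (\<Sum>x\<in>P. measure lborel {t\<in>{0..<1}. S t = x})"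
    proof (rule measure_finite_Union)
      show "(\<lambda>x. {t \<in> {0..<1}. S t = x}) ` P \<subseteq> sets lborel"
        using rising_level_borel[OF assms] by auto
      show "disjoint_family_on (\<lambda>x. {t \<in> {0..<1}. S t = x}) P"
        by (auto simp: disjoint_family_on_def)
      fix x
      have "emeasure lborel {t \<in> {0..<1}. S t = x} \<le> emeasure lborel {0..<1::real}"
        by (rule emeasure_mono) auto
      also have "\<dots> < \<infinity>" by simp
      finally show "emeasure lborel {t \<in> {0..<1}. S t = x} \<noteq> \<infinity>"
        by simp
    qed (rule finite_P)
    moreover have "(\<Union>x\<in>P. {t\<in>{0..<1::real}. S t = x}) = {0..<1}"
      using assms unfolding rising_def by blast
    moreover have "measure lborel {0..<1::real} = 1" by simp
    ultimately show ?thesis unfolding law_def by metis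
  qed
  moreover have "{x. law S x \<noteq> 0} \<subseteq> P"
    using law_pos_attained[of S] assms unfolding rising_def by auto
  moreover have "is_chain le {x. law S x \<noteq> 0}"
    unfolding is_chain_def
  proof (intro ballI)
    fix x y assume "x \<in> {x. law S x \<noteq> 0}" "y \<in> {x. law S x \<noteq> 0}"
    then obtain t t' where t: "t \<in> {0..<1}" "t' \<in> {0..<1}" and S: "S t = x" "S t' = y"
      using law_pos_attained[of S x] law_pos_attained[of S y] by blast
    have "t \<le> t' \<or> t' \<le> t" by linarith
    then have "le (S t) (S t') \<or> le (S t') (S t)"
      using assms t unfolding rising_def by blast
    then show "le x y \<or> le y x" using S by simp
  qed
  moreover have "0 \<le> law S x" for x by (simp add: law_def)
  ultimately show ?thesis
    unfolding order_complex_realization_def by blast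
qed

text \<open>Dominated convergence for the indicators of the level sets; the countable exceptional
  set \<open>B\<close> is Lebesgue null.\<close>

lemma law_tendsto:
  assumes S: "\<And>n. rising (S n)" "rising S'" and B: "countable B"
    and ev: "\<And>t. t \<in> {0..<1} \<Longrightarrow> t \<notin> B \<Longrightarrow> \<forall>\<^sub>F n in sequentially. S n t = S' t"
  shows "(\<lambda>n. law (S n) x) \<longlonglongrightarrow> law S' x"
proof -
  define I where "I T = (indicator {t\<in>{0..<1}. T t = x} :: real \<Rightarrow> real)" for T
  have meas: "I T \<in> borel_measurable lborel" and int: "law T x = integral\<^sup>L lborel (I T)"
    if "rising T" for T
    using rising_level_borel[OF that, of x]
    by (auto simp: law_def I_def)
  have "(\<lambda>n. integral\<^sup>L lborel (I (S n))) \<longlonglongrightarrow> integral\<^sup>L lborel (I S')"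
  proof (rule integral_dominated_convergence[where w = "indicator {0..<1}"])
    show "integrable lborel (indicator {0..<1} :: real \<Rightarrow> real)"
      by (simp add: integrable_indicator_iff)
    show "AE t in lborel. (\<lambda>n. I (S n) t) \<longlonglongrightarrow> I S' t"
    proof (rule AE_mp[OF AE_not_in[OF countable_imp_null_set_lborel[OF B]]], rule AE_I2, rule impI)
      fix t assume "t \<notin> B"
      show "(\<lambda>n. I (S n) t) \<longlonglongrightarrow> I S' t"
      proof (cases "t \<in> {0..<1}")
        case True
        have "\<forall>\<^sub>F n in sequentially. I (S n) t = I S' t"
          using ev[OF True \<open>t \<notin> B\<close>] by eventually_elim (auto simp: I_def indicator_def)
        then show ?thesis by (rule tendsto_eventually)
      qed (auto simp: I_def indicator_def)
    qed
    show "AE t in lborel. norm (I (S n) t) \<le> indicator {0..<1} t" for n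
      by (auto simp: I_def indicator_def)
  qed (use S meas in auto)
  then show ?thesis using int S by simp
qed

section \<open>Points of the realization as laws\<close>

definition weight_below :: "('a \<Rightarrow> real) \<Rightarrow> 'a \<Rightarrow> real" where
  "weight_below p x = (\<Sum>y | y \<in> P \<and> le y x \<and> y \<noteq> x. p y)"

text \<open>Stacking the weights of a point of the realization in the order of its support chain cuts
  \<open>[0,1)\<close> into intervals, so the point is the law of a random chain element.\<close>

definition selects :: "('a \<Rightarrow> real) \<Rightarrow> real \<Rightarrow> 'a \<Rightarrow> bool" where
  "selects p t x \<longleftrightarrow> x \<in> P \<and> weight_below p x \<le> t \<and> t < weight_below p x + p x"

definition sel :: "('a \<Rightarrow> real) \<Rightarrow> real \<Rightarrow> 'a" where
  "sel p t = (THE x. selects p t x)"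

lemma weight_below_add_le:
  assumes "p \<in> R" "y \<in> P" "le y x" "y \<noteq> x"
  shows "weight_below p y + p y \<le> weight_below p x"
proof -
  have "weight_below p y + p y = sum p (insert y {z \<in> P. le z y \<and> z \<noteq> y})"
    using finite_P by (simp add: weight_below_def)
  also have "\<dots> \<le> weight_below p x"
    unfolding weight_below_def
  proof (rule sum_mono2)
    show "insert y {z \<in> P. le z y \<and> z \<noteq> y} \<subseteq> {z \<in> P. le z x \<and> z \<noteq> x}"
      using assms le_trans le_antisym by blast
  qed (use assms finite_P in \<open>auto simp: order_complex_realization_def\<close>)
  finally show ?thesis .
qed

text \<open>Nonzero weights make \<open>x\<close> and \<open>y\<close> comparable. If
  \<open>y\<close> were strictly below \<open>x\<close>, its interval would end no later than that
  of \<open>x\<close> begins, against \<open>t \<le> t'\<close>.\<close>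

lemma selects_mono:
  assumes p: "p \<in> R" and x: "selects p t x" and y: "selects p t' y" and "t \<le> t'"
  shows "le x y"
proof (rule ccontr)
  assume n: "\<not> le x y"
  have "p x \<noteq> 0" "p y \<noteq> 0" using x y by (auto simp: selects_def)
  then have "le y x" using n p by (auto simp: order_complex_realization_def is_chain_def)
  moreover have "y \<noteq> x" using n le_refl by auto
  ultimately have "weight_below p y + p y \<le> weight_below p x"
    using weight_below_add_le[OF p] y by (auto simp: selects_def)
  then show False using x y \<open>t \<le> t'\<close> by (auto simp: selects_def)
qed

lemma selects_unique: "p \<in> R \<Longrightarrow> selects p t x \<Longrightarrow> selects p t y \<Longrightarrow> x = y"
  using selects_mono le_antisym by (meson order_refl)

lemma sum_support_eq:
  assumes "p \<in> R" "A \<subseteq> P"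
  shows "sum p {x\<in>A. p x \<noteq> 0} = sum p A"
  by (rule sum.mono_neutral_left) (use assms finite_P in \<open>auto intro: finite_subset\<close>)

text \<open>The element to select is the least one in the support whose interval ends after
  \<open>t\<close>.\<close>

lemma selects_exists:
  assumes p: "p \<in> R" and t: "t \<in> {0..<1}"
  shows "\<exists>x. selects p t x"
proof -
  define C where "C = {x. p x \<noteq> 0}"
  have CP: "C \<subseteq> P" and finC: "finite C" and pos: "\<And>x. 0 \<le> p x"
    and tot: "\<And>x y. x \<in> C \<Longrightarrow> y \<in> C \<Longrightarrow> le x y \<or> le y x" and one: "sum p P = 1"
    using p finite_P by (auto simp: C_def order_complex_realization_def is_chain_def intro: finite_subset)
  \<comment> \<open>If the support inside \<open>B\<close> is the support up to \<open>g\<close>,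
    the interval of \<open>g\<close> ends at the total weight of \<open>B\<close>. Applied to all of
    \<open>P\<close> and to the strict predecessors of an element.\<close>
  have up: "weight_below p g + p g = sum p B"
    if "g \<in> B" "g \<in> P" "B \<subseteq> P" "\<And>y. y \<in> B \<Longrightarrow> p y \<noteq> 0 \<Longrightarrow> le y g"
      "\<And>y. le y g \<Longrightarrow> p y \<noteq> 0 \<Longrightarrow> y \<in> B" for g B
  proof -
    have "weight_below p g + p g = sum p (insert g {z \<in> P. le z g \<and> z \<noteq> g})"
      using finite_P by (simp add: weight_below_def)
    also have "\<dots> = sum p {z\<in>insert g {z \<in> P. le z g \<and> z \<noteq> g}. p z \<noteq> 0}"
      by (rule sum_support_eq[symmetric]) (use p that in auto)
    also have "{z\<in>insert g {z \<in> P. le z g \<and> z \<noteq> g}. p z \<noteq> 0} = {z\<in>B. p z \<noteq> 0}"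
      using that le_refl by auto
    also have "sum p \<dots> = sum p B" by (rule sum_support_eq) (use p that in auto)
    finally show ?thesis .
  qed
  have "C \<noteq> {}"
  proof
    assume "C = {}"
    then have "sum p P = 0" by (intro sum.neutral) (auto simp: C_def)
    then show False using one by simp
  qed
  then obtain g where g: "g \<in> C" "\<And>x. x \<in> C \<Longrightarrow> le x g"
    using finite_total_greatest[OF finC] tot le_trans by metis
  define D where "D = {x\<in>C. t < weight_below p x + p x}"
  have "weight_below p g + p g = sum p P"
    by (rule up) (use g CP in \<open>auto simp: C_def\<close>)
  then have "g \<in> D" using g(1) one t by (simp add: D_def)
  moreover have "finite D" "\<And>x y. x \<in> D \<Longrightarrow> y \<in> D \<Longrightarrow> le y x \<or> le x y"
    using finC tot by (auto simp: D_def)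
  ultimately obtain x where x: "x \<in> D" "\<And>y. y \<in> D \<Longrightarrow> le x y"
    using finite_total_greatest[of D "\<lambda>a b. le b a"] le_trans by blast
  have "weight_below p x \<le> t"
  proof (rule ccontr)
    assume c: "\<not> ?thesis"
    \<comment> \<open>The interval of the greatest strict predecessor \<open>h\<close> would end at
      \<open>weight_below p x\<close>, hence after \<open>t\<close>. Then \<open>h\<close> is in
      \<open>D\<close>, below its least element \<open>x\<close>.\<close>
    define E where "E = {y\<in>C. le y x \<and> y \<noteq> x}"
    have wE: "weight_below p x = sum p E"
      unfolding weight_below_def E_def
      by (subst sum_support_eq[OF p, symmetric]) (use CP in \<open>auto simp: C_def intro!: sum.cong\<close>)
    have "E \<noteq> {}" using c wE t by auto
    moreover have "finite E" "\<And>x y. x \<in> E \<Longrightarrow> y \<in> E \<Longrightarrow> le x y \<or> le y x"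
      using finC tot by (auto simp: E_def)
    ultimately obtain h where h: "h \<in> E" "\<And>y. y \<in> E \<Longrightarrow> le y h"
      using finite_total_greatest[of E le] le_trans by metis
    have "weight_below p h + p h = sum p E"
    proof (rule up)
      fix y assume y: "le y h" "p y \<noteq> 0"
      show "y \<in> E" using h(1) y le_trans le_antisym unfolding E_def C_def by blast
    qed (use h CP in \<open>auto simp: E_def\<close>)
    then have "h \<in> D" using h(1) c wE by (auto simp: D_def E_def)
    then show False using x(2)[of h] h(1) le_antisym by (auto simp: E_def)
  qed
  then show ?thesis using x(1) CP by (auto simp: selects_def D_def)
qed

lemma selects_sel:
  assumes "p \<in> R" "t \<in> {0..<1}"
  shows "selects p t (sel p t)"
  unfolding sel_def using selects_exists[OF assms] selects_unique[OF assms(1)]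
  by (metis theI)

lemma sel_eqI: "p \<in> R \<Longrightarrow> selects p t x \<Longrightarrow> sel p t = x"
  unfolding sel_def using selects_unique by blast

lemma sel_support: "p \<in> R \<Longrightarrow> t \<in> {0..<1} \<Longrightarrow> p (sel p t) \<noteq> 0"
  using selects_sel[of p t] by (auto simp: selects_def)

lemma rising_sel: "p \<in> R \<Longrightarrow> rising (sel p)"
  unfolding rising_def
proof (intro conjI ballI impI)
  fix t :: real assume "p \<in> R" "t \<in> {0..<1}"
  then show "sel p t \<in> P" using selects_sel by (auto simp: selects_def)
next
  fix t t' :: real assume "p \<in> R" "t \<in> {0..<1}" "t' \<in> {0..<1}" "t \<le> t'"
  then show "le (sel p t) (sel p t')" using selects_mono[of p t _ t'] selects_sel by blast
qed

text \<open>The level set of \<open>x\<close> is its half-open interval, of length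
  \<open>p x\<close>; the bound by 1 keeps it inside \<open>[0,1)\<close>.\<close>

lemma law_sel:
  assumes p: "p \<in> R"
  shows "law (sel p) = p"
proof
  fix x
  have pos: "\<And>x. 0 \<le> p x" and out: "\<And>x. x \<notin> P \<Longrightarrow> p x = 0" and one: "sum p P = 1"
    using p by (auto simp: order_complex_realization_def)
  show "law (sel p) x = p x"
  proof (cases "x \<in> P")
    case True
    have "weight_below p x + p x = sum p (insert x {z \<in> P. le z x \<and> z \<noteq> x})"
      using finite_P by (simp add: weight_below_def)
    also have "\<dots> \<le> sum p P"
      by (rule sum_mono2) (use finite_P pos True in auto)
    finally have le1: "weight_below p x + p x \<le> 1" using one by simp
    have ge0: "0 \<le> weight_below p x" unfolding weight_below_def by (rule sum_nonneg) (rule pos)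
    have "{t\<in>{0..<1}. sel p t = x} = {weight_below p x..<weight_below p x + p x}"
    proof (intro equalityI subsetI)
      fix t assume "t \<in> {t\<in>{0..<1}. sel p t = x}"
      then show "t \<in> {weight_below p x..<weight_below p x + p x}"
        using selects_sel[OF p, of t] by (auto simp: selects_def)
    next
      fix t assume "t \<in> {weight_below p x..<weight_below p x + p x}"
      then show "t \<in> {t\<in>{0..<1}. sel p t = x}"
        using le1 ge0 True sel_eqI[OF p, of t x] by (auto simp: selects_def)
    qed
    then show ?thesis using pos by (simp add: law_def)
  next
    case False
    then show ?thesis
      using law_in_realization[OF rising_sel[OF p]] out
      by (auto simp: order_complex_realization_def)
  qed
qed

text \<open>Once \<open>t\<close> avoids the finitely many interval starts it is interior to its
  interval, whose ends depend continuously on the weights.\<close>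

lemma sel_eventually_const:
  assumes p: "\<And>n. p n \<in> R" "q \<in> R" and lim: "\<And>x. (\<lambda>n. p n x) \<longlonglongrightarrow> q x"
    and t: "t \<in> {0..<1}" "t \<notin> weight_below q ` P"
  shows "\<forall>\<^sub>F n in sequentially. sel (p n) t = sel q t"
proof -
  define x where "x = sel q t"
  have x: "x \<in> P" "weight_below q x \<le> t" "t < weight_below q x + q x"
    using selects_sel[OF p(2) t(1)] by (auto simp: x_def selects_def)
  have wl: "(\<lambda>n. weight_below (p n) x) \<longlonglongrightarrow> weight_below q x"
    unfolding weight_below_def by (intro tendsto_sum lim)
  have "weight_below q x < t" using x t(2) by (metis image_eqI order_le_less)
  then have "\<forall>\<^sub>F n in sequentially. weight_below (p n) x < t"
    using order_tendstoD(2)[OF wl] by blast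
  moreover have "\<forall>\<^sub>F n in sequentially. t < weight_below (p n) x + p n x"
    using order_tendstoD(1)[OF tendsto_add[OF wl lim] x(3)] .
  ultimately show ?thesis
  proof eventually_elim
    case (elim n)
    then show ?case
      unfolding x_def[symmetric] by (intro sel_eqI p) (use x in \<open>auto simp: selects_def\<close>)
  qed
qed

section \<open>Closed faces of the order complex\<close>

definition face :: "'a set \<Rightarrow> ('a \<Rightarrow> real) set" where
  "face C = {p. (\<forall>x. 0 \<le> p x) \<and> (\<forall>x. x \<notin> C \<longrightarrow> p x = 0) \<and> sum p P = 1}"

definition chains :: "'a set set" where
  "chains = {C. C \<subseteq> P \<and> is_chain le C}"

lemma finite_chains: "finite chains"
  unfolding chains_def using finite_P by auto

lemma support_chain: "p \<in> R \<Longrightarrow> {x. p x \<noteq> 0} \<in> chains"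
  by (auto simp: order_complex_realization_def chains_def)

lemma face_subset: "C \<in> chains \<Longrightarrow> face C \<subseteq> R"
  unfolding face_def chains_def order_complex_realization_def is_chain_def by blast

text \<open>Every point lies in the face of its own support. These are finitely many closed
  simplices, so continuity can be checked on each and pasted.\<close>

lemma realization_eq_Union_faces: "R = (\<Union>C\<in>chains. face C)"
proof
  show "R \<subseteq> (\<Union>C\<in>chains. face C)"
  proof
    fix p assume p: "p \<in> R"
    then have "p \<in> face {x. p x \<noteq> 0}"
      by (auto simp: order_complex_realization_def face_def)
    then show "p \<in> (\<Union>C\<in>chains. face C)" using support_chain[OF p] by blast
  qed
qed (use face_subset in blast)

lemma closed_face: "closed (face C)"
proof -
  have c: "continuous_on UNIV (\<lambda>p::'a\<Rightarrow>real. p x)" for x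
    by (rule continuous_on_product_coordinates)
  have "face C = (\<Inter>x. {p. 0 \<le> p x}) \<inter> (\<Inter>x\<in>-C. {p. p x = 0}) \<inter> {p. sum p P = 1}"
    by (auto simp: face_def)
  moreover have "closed {p::'a\<Rightarrow>real. 0 \<le> p x}" "closed {p::'a\<Rightarrow>real. p x = 0}" for x
    by (intro closed_Collect_le closed_Collect_eq continuous_on_const c)+
  moreover have "closed {p::'a\<Rightarrow>real. sum p P = 1}"
    by (intro closed_Collect_eq continuous_on_const continuous_on_sum c)
  ultimately show ?thesis by (auto intro!: closed_Int closed_INT)
qed

lemma geom_realization_eq: "geom_realization P le = top_of_set R"
  unfolding geom_realization_def euclidean_product_topology ..

end

section \<open>Height functions of cellular strings\<close>

definition sym_of :: "int \<Rightarrow> int \<Rightarrow> sym" where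
  "sym_of a b = (if a = b then if even a then S0 else S1 else SX)"

lemma sym_of_shift: "even k \<Longrightarrow> sym_of (a + k) (b + k) = sym_of a b"
  by (auto simp: sym_of_def)

text \<open>The last inequality lets an X between \<open>j\<close> and \<open>j + 1\<close> be
  followed only by the same X or by the bit of height \<open>j + 1\<close>, and a bit of height
  \<open>j\<close> only by itself, by that X or by the bit of height \<open>j + 1\<close>.\<close>

definition steps :: "(nat \<Rightarrow> int) \<Rightarrow> (nat \<Rightarrow> int) \<Rightarrow> bool" where
  "steps l u \<longleftrightarrow> (\<forall>i. l i \<le> u i \<and> l i \<le> l (Suc i) \<and> u i \<le> u (Suc i) \<and> u (Suc i) \<le> l i + 1)"

lemma stepsD:
  assumes "steps l u"
  shows "l i \<le> u i" "l i \<le> l (Suc i)" "u i \<le> u (Suc i)" "u (Suc i) \<le> l i + 1"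
    "u i \<le> l i + 1" "l (Suc i) \<le> l i + 1" "u (Suc i) \<le> u i + 1"
  using assms unfolding steps_def by (smt (verit, best))+

text \<open>A bit block starts exactly where \<open>l\<close> rises, and the parity of the new value
  is its symbol. So 0-blocks count the even values passed and 1-blocks the odd ones.\<close>

lemma block_starts_telescope:
  assumes st: "steps l u"
  shows "int (card {i. i < n \<and> sym_of (l (Suc (k + i))) (u (Suc (k + i))) = S0 \<and> sym_of (l (k + i)) (u (k + i)) \<noteq> S0})
           = l (k + n) div 2 - l k div 2"
    and "int (card {i. i < n \<and> sym_of (l (Suc (k + i))) (u (Suc (k + i))) = S1 \<and> sym_of (l (k + i)) (u (k + i)) \<noteq> S1})
           = (l (k + n) + 1) div 2 - (l k + 1) div 2"
proof -
  have card_Suc: "int (card {i. i < Suc n \<and> Q i}) = int (card {i. i < n \<and> Q i}) + of_bool (Q n)" for Q n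
  proof (cases "Q n")
    case True
    then have "{i. i < Suc n \<and> Q i} = insert n {i. i < n \<and> Q i}" by (auto simp: less_Suc_eq)
    then show ?thesis using True by simp
  next
    case False
    then have "{i. i < Suc n \<and> Q i} = {i. i < n \<and> Q i}" by (auto simp: less_Suc_eq)
    then show ?thesis using False by simp
  qed
  have S0: "of_bool (sym_of (l (Suc j)) (u (Suc j)) = S0 \<and> sym_of (l j) (u j) \<noteq> S0)
      = l (Suc j) div 2 - l j div 2" for j
  proof -
    have "l (Suc j) = l j \<or> l (Suc j) = l j + 1 \<and> u (Suc j) = l j + 1"
      using stepsD[OF st, of j] stepsD(1)[OF st, of "Suc j"] by linarith
    then show ?thesis
      using stepsD[OF st, of j] unfolding sym_of_def by auto
  qed
  have S1: "of_bool (sym_of (l (Suc j)) (u (Suc j)) = S1 \<and> sym_of (l j) (u j) \<noteq> S1)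
      = (l (Suc j) + 1) div 2 - (l j + 1) div 2" for j
  proof -
    have "l (Suc j) = l j \<or> l (Suc j) = l j + 1 \<and> u (Suc j) = l j + 1"
      using stepsD[OF st, of j] stepsD(1)[OF st, of "Suc j"] by linarith
    then show ?thesis
      using stepsD[OF st, of j] unfolding sym_of_def by auto
  qed
  show "int (card {i. i < n \<and> sym_of (l (Suc (k + i))) (u (Suc (k + i))) = S0 \<and> sym_of (l (k + i)) (u (k + i)) \<noteq> S0})
           = l (k + n) div 2 - l k div 2"
  proof (induction n)
    case (Suc n)
    then show ?case unfolding card_Suc S0 by simp
  qed simp
  show "int (card {i. i < n \<and> sym_of (l (Suc (k + i))) (u (Suc (k + i))) = S1 \<and> sym_of (l (k + i)) (u (k + i)) \<noteq> S1})
           = (l (k + n) + 1) div 2 - (l k + 1) div 2"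
  proof (induction n)
    case (Suc n)
    then show ?case unfolding card_Suc S1 by simp
  qed simp
qed

lemma cyc_add_length [simp]: "cyc s (i + length s) = cyc s i"
  by (simp add: cyc_def)

text \<open>Telescoping starts at \<open>N - 1\<close>, which stands for position -1, so that
  predecessors are natural numbers. The nonconstancy premises exclude the case where
  \<open>num_blocks\<close> is 1 by convention.\<close>

lemma num_blocks_steps:
  assumes st: "steps l u" and s: "\<And>i. cyc s i = sym_of (l i) (u i)" and "s \<noteq> []"
    and per: "\<And>i. l (i + length s) = l i + 2 * D"
  shows "\<exists>i<length s. s ! i \<noteq> S0 \<Longrightarrow> int (num_blocks s S0) = D"
    and "\<exists>i<length s. s ! i \<noteq> S1 \<Longrightarrow> int (num_blocks s S1) = D"
proof -
  define N where "N = length s"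
  have N: "N > 0" using \<open>s \<noteq> []\<close> by (simp add: N_def)
  have nth: "s ! i = sym_of (l (Suc (N - 1 + i))) (u (Suc (N - 1 + i)))" if "i < N" for i
  proof -
    have "s ! i = cyc s (i + N)" using that by (simp add: N_def cyc_def)
    then show ?thesis using s[of "i + N"] N by (simp add: add.commute)
  qed
  have prev: "cyc s (i + N - 1) = sym_of (l (N - 1 + i)) (u (N - 1 + i))" for i
    using s[of "N - 1 + i"] N by (simp add: add.commute)
  have set_eq: "{i. i < N \<and> s ! i = c \<and> cyc s (i + N - 1) \<noteq> c} =
      {i. i < N \<and> sym_of (l (Suc (N - 1 + i))) (u (Suc (N - 1 + i))) = c \<and>
        sym_of (l (N - 1 + i)) (u (N - 1 + i)) \<noteq> c}" for c
    using nth prev by auto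
  have per': "l (N - 1 + N) = l (N - 1) + 2 * D" using per[of "N - 1"] by (simp add: N_def)
  show "int (num_blocks s S0) = D" if "\<exists>i<length s. s ! i \<noteq> S0"
  proof -
    have "num_blocks s S0 = card {i. i < N \<and> s ! i = S0 \<and> cyc s (i + N - 1) \<noteq> S0}"
      using that by (auto simp: num_blocks_def N_def)
    then show ?thesis
      unfolding set_eq using block_starts_telescope(1)[OF st, of N "N - 1"] per' by simp
  qed
  show "int (num_blocks s S1) = D" if "\<exists>i<length s. s ! i \<noteq> S1"
  proof -
    have "num_blocks s S1 = card {i. i < N \<and> s ! i = S1 \<and> cyc s (i + N - 1) \<noteq> S1}"
      using that by (auto simp: num_blocks_def N_def)
    moreover have "(x + 2 * D + 1) div 2 - (x + 1) div 2 = D" for x by presburger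
    ultimately show ?thesis
      unfolding set_eq using block_starts_telescope(2)[OF st, of N "N - 1"] per' by simp
  qed
qed

lemma num_blocks_pos_imp_occurs: "0 < num_blocks s c \<Longrightarrow> \<exists>i<length s. s ! i = c"
  by (auto simp: num_blocks_def card_gt_0_iff split: if_splits)

text \<open>Moves the condition of \<open>X_blocks_ok\<close> from indices below
  \<open>length s\<close> to runs anywhere in the unrolled string. A run of full period length would
  meet a copy of the bit at \<open>k\<close>.\<close>

lemma X_run_between_distinct_bits:
  assumes ok: "X_blocks_ok s" and "s \<noteq> []"
    and b: "cyc s k \<noteq> SX" and x: "\<And>i. k < i \<Longrightarrow> i \<le> k + d \<Longrightarrow> cyc s i = SX"
    and e: "cyc s (Suc (k + d)) \<noteq> SX" and "0 < d"
  shows "cyc s (Suc (k + d)) \<noteq> cyc s k"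
proof -
  define N where "N = length s"
  have N: "N > 0" using \<open>s \<noteq> []\<close> by (simp add: N_def)
  have "d < N"
  proof (rule ccontr)
    assume "\<not> d < N"
    then have "cyc s (k + N) = SX" using x N by simp
    then show False using b by (simp add: N_def)
  qed
  define i where "i = Suc k mod N"
  have i: "i < N" using N by (simp add: i_def)
  have shift: "cyc s (i + j) = cyc s (Suc k + j)" for j
    unfolding cyc_def i_def N_def[symmetric] by (simp add: mod_add_left_eq)
  have prev: "cyc s (i + N - 1) = cyc s k"
  proof -
    have "i + N - 1 = i + (N - 1)" using N by simp
    then have "cyc s (i + N - 1) = cyc s (Suc k + (N - 1))" using shift by simp
    also have "Suc k + (N - 1) = k + N" using N by simp
    finally show ?thesis by (simp add: N_def)
  qed
  \<comment> \<open>In \<open>X_blocks_ok\<close> the parameter is the last offset of the run, one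
    less than the run length \<open>d\<close> here.\<close>
  have "(\<forall>j\<le>d - 1. cyc s (i + j) = SX)" using shift x \<open>0 < d\<close> by auto
  moreover have "cyc s (i + (d - 1) + 1) = cyc s (Suc (k + d))"
    using shift[of d] \<open>0 < d\<close> by simp
  ultimately have "cyc s k \<noteq> cyc s (Suc (k + d))"
    using ok i \<open>d < N\<close> prev b e unfolding X_blocks_ok_def N_def[symmetric]
    by (metis less_imp_diff_less)
  then show ?thesis by simp
qed

section \<open>Strings as height pairs\<close>

locale cellular_strings =
  fixes N M :: nat
  assumes M_pos: "0 < M" and M_less: "2 * M < N"
begin

lemma N_pos: "0 < N"
  using M_less by simp

text \<open>A height pair is a string unrolled to the universal cover of the circle: a bit at position
  \<open>i\<close> of the \<open>j\<close>-th block has \<open>l i = u i = j\<close>, with \<open>j\<close> even for the symbol 0, and an X between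
  blocks \<open>j\<close> and \<open>j + 1\<close> has \<open>l i = j\<close> and \<open>u i = j + 1\<close>.\<close>

definition heights :: "(nat \<Rightarrow> int) \<Rightarrow> (nat \<Rightarrow> int) \<Rightarrow> bool" where
  "heights l u \<longleftrightarrow> steps l u \<and>
     (\<forall>i. l (i + N) = l i + 2 * int M) \<and> (\<forall>i. u (i + N) = u i + 2 * int M)"

definition string_of :: "(nat \<Rightarrow> int) \<Rightarrow> (nat \<Rightarrow> int) \<Rightarrow> sym list" where
  "string_of l u = map (\<lambda>i. sym_of (l i) (u i)) [0..<N]"

lemma length_string_of [simp]: "length (string_of l u) = N"
  by (simp add: string_of_def)

lemma nth_string_of [simp]: "i < N \<Longrightarrow> string_of l u ! i = sym_of (l i) (u i)"
  by (simp add: string_of_def)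

lemma heights_steps: "heights l u \<Longrightarrow> steps l u"
  by (simp add: heights_def)

lemma heights_add_mult:
  assumes "heights l u"
  shows "l (i + k * N) = l i + 2 * int M * int k" "u (i + k * N) = u i + 2 * int M * int k"
proof -
  have eq: "i + Suc k * N = (i + k * N) + N" for k by simp
  show "l (i + k * N) = l i + 2 * int M * int k"
  proof (induction k)
    case (Suc k)
    have "l (i + k * N + N) = l (i + k * N) + 2 * int M" "u (i + k * N + N) = u (i + k * N) + 2 * int M"
      using assms unfolding heights_def by blast+
    then show ?case unfolding eq using Suc by (simp add: algebra_simps)
  qed simp
  show "u (i + k * N) = u i + 2 * int M * int k"
  proof (induction k)
    case (Suc k)
    have "l (i + k * N + N) = l (i + k * N) + 2 * int M" "u (i + k * N + N) = u (i + k * N) + 2 * int M"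
      using assms unfolding heights_def by blast+
    then show ?case unfolding eq using Suc by (simp add: algebra_simps)
  qed simp
qed

lemma cyc_string_of:
  assumes "heights l u"
  shows "cyc (string_of l u) i = sym_of (l i) (u i)"
proof -
  have i: "i = i mod N + (i div N) * N" by simp
  have "sym_of (l i) (u i) = sym_of (l (i mod N) + 2 * int M * int (i div N)) (u (i mod N) + 2 * int M * int (i div N))"
    using heights_add_mult[OF assms, of "i mod N" "i div N"] by simp
  also have "\<dots> = sym_of (l (i mod N)) (u (i mod N))"
    by (rule sym_of_shift) simp
  finally show ?thesis using N_pos by (simp add: cyc_def)
qed

lemma heights_shift:
  assumes "heights l u" "even k"
  shows "heights (\<lambda>i. l i + k) (\<lambda>i. u i + k)" "string_of (\<lambda>i. l i + k) (\<lambda>i. u i + k) = string_of l u"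
  using assms by (auto simp: heights_def steps_def string_of_def sym_of_shift)

lemma heights_unbounded: "heights l u \<Longrightarrow> l N \<noteq> l 0" "heights l u \<Longrightarrow> u N \<noteq> u 0"
  using M_pos heights_add_mult[of l u 0 1] by auto

text \<open>At an X, \<open>u\<close> is already \<open>l + 1\<close> and has no room to rise. With
  X everywhere \<open>u\<close> would be constant, against its growth over a period.\<close>

lemma heights_bit:
  assumes h: "heights l u"
  shows "\<exists>i. l i = u i"
proof (rule ccontr)
  assume n: "\<nexists>i. l i = u i"
  have "u i = u 0" for i
  proof (induction i)
    case (Suc i)
    have "l i \<noteq> u i" using n by blast
    then show ?case using stepsD[OF heights_steps[OF h], of i] Suc by linarith
  qed simp
  then show False using heights_unbounded(2)[OF h] by blast
qed

text \<open>After a bit of height \<open>j\<close> an X run keeps the heights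
  \<open>(j, j + 1)\<close>, so the next bit has height \<open>j + 1\<close> and the opposite
  parity. Block counts come from telescoping.\<close>

lemma string_of_in_Str:
  assumes h: "heights l u"
  shows "string_of l u \<in> Str N M"
proof -
  let ?s = "string_of l u"
  note st = heights_steps[OF h]
  have cyc: "\<And>i. cyc ?s i = sym_of (l i) (u i)" by (rule cyc_string_of[OF h])
  have ne: "?s \<noteq> []" using N_pos by (metis length_string_of length_greater_0_conv)
  have per: "\<And>i. l (i + length ?s) = l i + 2 * int M" using h by (simp add: heights_def)
  \<comment> \<open>Any change of the heights in one step changes the symbol, so a constant string
    would have constant heights.\<close>
  have nconst: "\<exists>i<N. ?s ! i \<noteq> c" for c
  proof (rule ccontr)
    assume "\<not> ?thesis"
    then have "cyc ?s i = c" for i using N_pos by (simp add: cyc_def)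
    then have eq: "sym_of (l i) (u i) = c" for i using cyc by simp
    have "l i = l 0 \<and> u i = u 0" for i
    proof (induction i)
      case (Suc i)
      have "sym_of (l (Suc i)) (u (Suc i)) = sym_of (l i) (u i)" using eq by simp
      then have "l (Suc i) = l i \<and> u (Suc i) = u i"
        using stepsD[OF st, of i] stepsD(1,5)[OF st, of "Suc i"]
        unfolding sym_of_def by (auto split: if_splits) presburger+
      then show ?case using Suc by simp
    qed simp
    then show False using heights_unbounded(1)[OF h] by blast
  qed
  have "X_blocks_ok ?s"
    unfolding X_blocks_ok_def
  proof (intro conjI allI impI; (elim conjE)?)
    fix i d
    assume i: "i < length ?s" and run: "\<forall>k\<le>d. cyc ?s (i + k) = SX"
      and b: "cyc ?s (i + length ?s - 1) \<noteq> SX" and e: "cyc ?s (i + d + 1) \<noteq> SX"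
    \<comment> \<open>The position just before the run, taken one period later so that it is a
      natural number.\<close>
    define k where "k = i + N - 1"
    have ki: "Suc (k + j) = i + j + N" for j using N_pos by (simp add: k_def)
    have b': "l k = u k" using b cyc[of k] by (auto simp: k_def sym_of_def split: if_splits)
    have run': "sym_of (l (Suc (k + j))) (u (Suc (k + j))) = SX" if "j \<le> d" for j
    proof -
      have "cyc ?s (i + j + N) = cyc ?s (i + j)" using cyc_add_length[of ?s "i + j"] by simp
      then show ?thesis using run that cyc ki by metis
    qed
    have in_run: "l (Suc (k + j)) = l k \<and> u (Suc (k + j)) = l k + 1" if "j \<le> d" for j
      using that
    proof (induction j)
      case 0
      then show ?case using run'[of 0] stepsD[OF st, of k] stepsD(1)[OF st, of "Suc k"] b'
        by (auto simp: sym_of_def split: if_splits)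
    next
      case (Suc j)
      then show ?case using run'[of "Suc j"] stepsD[OF st, of "Suc (k + j)"] stepsD(1)[OF st, of "Suc (Suc (k + j))"]
        by (auto simp: sym_of_def split: if_splits)
    qed
    have e': "cyc ?s (i + d + 1) = sym_of (l (Suc (Suc (k + d)))) (u (Suc (Suc (k + d))))"
    proof -
      have "cyc ?s (i + d + 1 + N) = cyc ?s (i + d + 1)" using cyc_add_length[of ?s "i + d + 1"] by simp
      moreover have "i + d + 1 + N = Suc (Suc (k + d))" using ki[of d] by simp
      ultimately show ?thesis using cyc by metis
    qed
    have fin: "l (Suc (Suc (k + d))) = l k + 1 \<and> u (Suc (Suc (k + d))) = l k + 1"
      using e in_run[of d] stepsD[OF st, of "Suc (k + d)"] stepsD(1)[OF st, of "Suc (Suc (k + d))"]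
      unfolding e' by (auto simp: sym_of_def split: if_splits)
    show "cyc ?s (i + length ?s - 1) \<noteq> cyc ?s (i + d + 1)"
      unfolding e' using fin b' cyc[of k] by (auto simp: k_def sym_of_def)
    show "is_bit (cyc ?s (i + length ?s - 1))" "is_bit (cyc ?s (i + d + 1))"
      using b e by (auto simp: is_bit_def)
  next
    show "\<not> (?s \<noteq> [] \<and> (\<forall>i<length ?s. ?s ! i = SX))" using nconst[of SX] by auto
  qed
  moreover have "int (num_blocks ?s S0) = int M" "int (num_blocks ?s S1) = int M"
    using num_blocks_steps[OF st cyc ne per] nconst by simp_all
  ultimately show ?thesis by (simp add: Str_def)
qed

text \<open>Read the string cyclically from some 0, updating the height pair at each symbol. The
  parity can only go wrong on leaving an X run, where \<open>X_blocks_ok\<close> applies.\<close>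

lemma heights_exist:
  assumes s: "s \<in> Str N M"
  shows "\<exists>l u. heights l u \<and> string_of l u = s"
proof -
  have len: "length s = N" and nb: "num_blocks s S0 = M" "num_blocks s S1 = M" and ok: "X_blocks_ok s"
    using s by (auto simp: Str_def)
  have ne: "s \<noteq> []" using len N_pos by auto
  have cyc_per: "cyc s (i + N) = cyc s i" for i using cyc_add_length[of s i] by (simp add: len)
  obtain i0 where i0: "i0 < N" "s ! i0 = S0"
    using num_blocks_pos_imp_occurs[of s S0] nb(1) M_pos len by auto
  obtain i1 where i1: "i1 < N" "s ! i1 = S1"
    using num_blocks_pos_imp_occurs[of s S1] nb(2) M_pos len by auto
  \<comment> \<open>The only pair that \<open>steps\<close> permits after \<open>h\<close> and that
    can show \<open>c\<close>. Leaving an X, every bit gets height \<open>fst h + 1\<close>; that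
    its parity fits is part of the invariant below.\<close>
  define next_h :: "int \<times> int \<Rightarrow> sym \<Rightarrow> int \<times> int" where
    "next_h h c = (if c = sym_of (fst h) (snd h) then h else if c = SX then (fst h, fst h + 1)
       else (fst h + 1, fst h + 1))" for h c
  define m where "m = rec_nat (0, 0) (\<lambda>j h. next_h h (cyc s (Suc (i0 + j))))"
  have m0: "m 0 = (0, 0)" and mS: "m (Suc j) = next_h (m j) (cyc s (Suc (i0 + j)))" for j
    by (simp_all add: m_def)
  \<comment> \<open>At an X the invariant remembers the position \<open>j'\<close> of the bit that
    opened the run, to be compared with the bit that closes it.\<close>
  have inv: "sym_of (fst (m j)) (snd (m j)) = cyc s (i0 + j) \<and>
      fst (m j) \<le> snd (m j) \<and> snd (m j) \<le> fst (m j) + 1 \<and>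
      (cyc s (i0 + j) = SX \<longrightarrow> (\<exists>j'<j. m j' = (fst (m j), fst (m j)) \<and>
         cyc s (i0 + j') = sym_of (fst (m j)) (fst (m j)) \<and>
         (\<forall>i. i0 + j' < i \<and> i \<le> i0 + j \<longrightarrow> cyc s i = SX)))" for j
  proof (induction j)
    case 0
    then show ?case using i0 len by (simp add: m0 sym_of_def cyc_def)
  next
    case (Suc j)
    obtain a b where ab: "m j = (a, b)" by fastforce
    let ?c = "cyc s (Suc (i0 + j))"
    have IH: "sym_of a b = cyc s (i0 + j)" "a \<le> b" "b \<le> a + 1" using Suc ab by auto
    consider (same) "?c = sym_of a b" "?c \<noteq> SX" | (sameX) "?c = sym_of a b" "?c = SX"
      | (toX) "?c \<noteq> sym_of a b" "?c = SX" | (flip) "?c \<noteq> sym_of a b" "?c \<noteq> SX" "a = b"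
      | (fromX) "?c \<noteq> sym_of a b" "?c \<noteq> SX" "a \<noteq> b" by blast
    then show ?case
    proof cases
      case same
      then have "m (Suc j) = (a, b)" by (simp add: mS next_h_def ab)
      then show ?thesis using same IH by auto
    next
      case sameX
      then have mm: "m (Suc j) = (a, b)" by (simp add: mS next_h_def ab)
      have "cyc s (i0 + j) = SX" using sameX IH by simp
      then obtain j' where j': "j' < j" "m j' = (a, a)" "cyc s (i0 + j') = sym_of a a"
        "\<forall>i. i0 + j' < i \<and> i \<le> i0 + j \<longrightarrow> cyc s i = SX" using Suc ab by auto
      have "\<forall>i. i0 + j' < i \<and> i \<le> i0 + Suc j \<longrightarrow> cyc s i = SX"
        using j'(4) sameX(2) by (auto simp: le_Suc_eq)
      then show ?thesis using j' mm sameX IH by (auto intro!: exI[of _ j'])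
    next
      case toX
      have "a = b" using toX IH by (auto simp: sym_of_def split: if_splits)
      moreover have "m (Suc j) = (a, a + 1)" using toX by (simp add: mS next_h_def ab)
      moreover have "\<forall>i. i0 + j < i \<and> i \<le> i0 + Suc j \<longrightarrow> cyc s i = SX"
        using toX(2) by (auto simp: le_Suc_eq)
      ultimately show ?thesis using toX IH ab by (auto simp: sym_of_def intro!: exI[of _ j])
    next
      case flip
      then have "m (Suc j) = (a + 1, a + 1)" by (simp add: mS next_h_def ab)
      moreover have "?c = sym_of (a + 1) (a + 1)"
        using flip by (cases ?c) (auto simp: sym_of_def split: if_splits)
      ultimately show ?thesis using flip by auto
    next
      case fromX
      then have mm: "m (Suc j) = (a + 1, a + 1)" by (simp add: mS next_h_def ab)
      have "cyc s (i0 + j) = SX" using fromX IH by (simp add: sym_of_def)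
      then obtain j' where j': "j' < j" "m j' = (a, a)" "cyc s (i0 + j') = sym_of a a"
        "\<forall>i. i0 + j' < i \<and> i \<le> i0 + j \<longrightarrow> cyc s i = SX" using Suc ab by auto
      have "cyc s (Suc (i0 + j' + (j - j'))) \<noteq> cyc s (i0 + j')"
      proof (rule X_run_between_distinct_bits[OF ok ne])
        show "cyc s (i0 + j') \<noteq> SX" using j'(3) by (simp add: sym_of_def)
      qed (use j' fromX in auto)
      then have "?c \<noteq> sym_of a a" using j' by simp
      then have "?c = sym_of (a + 1) (a + 1)"
        using fromX by (cases ?c) (auto simp: sym_of_def split: if_splits)
      then show ?thesis using mm fromX by auto
    qed
  qed
  \<comment> \<open>Reading began at \<open>i0\<close>; this offset realigns to position 0, one
    period later.\<close>
  define off where "off = N - i0"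
  define l u where "l i = fst (m (i + off))" and "u i = snd (m (i + off))" for i
  have st: "steps l u"
    unfolding steps_def
  proof
    fix i
    show "l i \<le> u i \<and> l i \<le> l (Suc i) \<and> u i \<le> u (Suc i) \<and> u (Suc i) \<le> l i + 1"
      using inv[of "i + off"] by (auto simp: l_def u_def mS next_h_def sym_of_def split: if_splits)
  qed
  have cyc_lu: "cyc s i = sym_of (l i) (u i)" for i
  proof -
    have "i0 + (i + off) = i + N" using i0 by (simp add: off_def)
    then show ?thesis using inv[of "i + off"] cyc_per[of i] unfolding l_def u_def by metis
  qed
  \<comment> \<open>After one period the symbol is 0 again, so the height is even. Updates commute
    with even shifts, so this shift recurs each period; the count of 0-blocks then forces
    \<open>D = M\<close>.\<close>
  obtain D where D: "m N = (2 * D, 2 * D)"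
  proof -
    have "sym_of (fst (m N)) (snd (m N)) = S0" using inv[of N] cyc_per[of i0] i0 len by (simp add: cyc_def)
    then have "fst (m N) = snd (m N)" "even (fst (m N))" by (auto simp: sym_of_def split: if_splits)
    then show ?thesis using that by (metis evenE prod.collapse)
  qed
  have per_m: "m (j + N) = (fst (m j) + 2 * D, snd (m j) + 2 * D)" for j
  proof (induction j)
    case (Suc j)
    have "cyc s (Suc (i0 + (j + N))) = cyc s (Suc (i0 + j))"
      using cyc_per[of "Suc (i0 + j)"] by (simp add: add.assoc)
    then show ?case using Suc by (simp add: mS next_h_def sym_of_shift)
  qed (simp add: m0 D)
  have per: "l (i + N) = l i + 2 * D" "u (i + N) = u i + 2 * D" for i
    using per_m[of "i + off"] by (simp_all add: l_def u_def ac_simps)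
  have "int (num_blocks s S0) = D"
    by (rule num_blocks_steps(1)[OF st cyc_lu ne]) (use per i1 len in auto)
  then have "heights l u" using st per nb by (simp add: heights_def)
  moreover have "string_of l u = s"
  proof (rule nth_equalityI)
    fix i assume "i < length (string_of l u)"
    then show "string_of l u ! i = s ! i" using cyc_lu[of i] len by (simp add: cyc_def)
  qed (simp add: len)
  ultimately show ?thesis by blast
qed

section \<open>Heights of comparable strings\<close>

lemma str_le_string_ofD:
  assumes "heights l u" "heights l' u'" "str_le (string_of l' u') (string_of l u)"
  shows "sym_of (l' i) (u' i) = sym_of (l i) (u i) \<or> l i \<noteq> u i"
proof -
  have "i mod N < N" using N_pos by simp
  then have "cyc (string_of l' u') i = cyc (string_of l u) i \<or> cyc (string_of l u) i = SX"
    using assms(3) by (auto simp: str_le_def cyc_def)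
  then show ?thesis
    using cyc_string_of[OF assms(1), of i] cyc_string_of[OF assms(2), of i]
    by (auto simp: sym_of_def split: if_splits)
qed

text \<open>Going right from \<open>i0\<close>, whenever \<open>l\<close> rises the coarser string
  shows a bit, so the finer one shows the same bit; by parity \<open>l'\<close> cannot remain at the
  old value of \<open>l\<close>. Going left, the same argument bounds \<open>u'\<close>. Periodicity
  reaches the other positions.\<close>

lemma heights_nested:
  assumes h: "heights l u" "heights l' u'" and le: "str_le (string_of l' u') (string_of l u)"
    and i0: "l i0 = u i0" "l' i0 = l i0" "u' i0 = u i0"
  shows "l i \<le> l' i" "u' i \<le> u i"
proof -
  note st = heights_steps[OF h(1)] and st' = heights_steps[OF h(2)]
  note sym = str_le_string_ofD[OF h le]
  have fwd: "l (i0 + n) \<le> l' (i0 + n)" for n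
  proof (induction n)
    case (Suc n)
    show ?case
    proof (cases "l (Suc (i0 + n)) = l (i0 + n)")
      case True
      then show ?thesis using Suc stepsD(2)[OF st', of "i0 + n"] by simp
    next
      case False
      then have "l (Suc (i0 + n)) = l (i0 + n) + 1" "u (Suc (i0 + n)) = l (i0 + n) + 1"
        using stepsD[OF st, of "i0 + n"] stepsD(1)[OF st, of "Suc (i0 + n)"] by linarith+
      then have "sym_of (l' (Suc (i0 + n))) (u' (Suc (i0 + n))) = sym_of (l (i0 + n) + 1) (l (i0 + n) + 1)"
        using sym[of "Suc (i0 + n)"] by simp
      then have "even (l' (Suc (i0 + n))) \<longleftrightarrow> even (l (i0 + n) + 1)"
        by (auto simp: sym_of_def split: if_splits)
      then have "l' (Suc (i0 + n)) \<noteq> l (i0 + n)" by auto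
      then show ?thesis
        using Suc stepsD(2)[OF st', of "i0 + n"] \<open>l (Suc (i0 + n)) = l (i0 + n) + 1\<close> by simp
    qed
  qed (use i0 in simp)
  have bwd: "u' (K - n) \<le> u (K - n)" if "u' K = u K" for K n
  proof (induction n)
    case (Suc n)
    show ?case
    proof (cases "n < K")
      case True
      define j where "j = K - Suc n"
      have Sj: "K - n = Suc j" using True by (simp add: j_def)
      show ?thesis
      proof (cases "u (Suc j) = u j")
        case True
        then show ?thesis using Suc stepsD(3)[OF st', of j] Sj j_def by simp
      next
        case False
        then have eq: "l j = u j" "u (Suc j) = u j + 1"
          using stepsD[OF st, of j] by linarith+
        then have "sym_of (l' j) (u' j) = sym_of (u j) (u j)" using sym[of j] by simp
        then have "even (u' j) \<longleftrightarrow> even (u j)" by (auto simp: sym_of_def split: if_splits)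
        then have "u' j \<noteq> u j + 1" by auto
        then show ?thesis using Suc stepsD(3)[OF st', of j] Sj j_def eq by simp
      qed
    qed (use Suc in simp)
  qed (use that in simp)
  show "l i \<le> l' i"
  proof -
    \<comment> \<open>Moving \<open>i\<close> by \<open>i0\<close> periods brings it to the right of
      \<open>i0\<close>, where \<open>fwd\<close> applies.\<close>
    have "i0 \<le> i0 * N" using N_pos by simp
    then have "i0 + (i + i0 * N - i0) = i + i0 * N" by linarith
    then have "l (i + i0 * N) \<le> l' (i + i0 * N)" using fwd[of "i + i0 * N - i0"] by metis
    then show ?thesis using heights_add_mult(1)[OF h(1)] heights_add_mult(1)[OF h(2)] by simp
  qed
  show "u' i \<le> u i"
  proof -
    have "i \<le> i0 + i * N" using N_pos by (simp add: trans_le_add2)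
    then have "i0 + i * N - (i0 + i * N - i) = i" by linarith
    moreover have "u' (i0 + i * N) = u (i0 + i * N)"
      using heights_add_mult(2)[OF h(1)] heights_add_mult(2)[OF h(2)] i0 by simp
    ultimately show ?thesis using bwd[of "i0 + i * N" "i0 + i * N - i"] by metis
  qed
qed

lemma heights_normalize:
  assumes h: "heights l u" "heights l' u'" and le: "str_le (string_of l' u') (string_of l u)"
    and i0: "l i0 = u i0"
  shows "l' i0 = u' i0" "even (l i0 - l' i0)"
proof -
  have "sym_of (l' i0) (u' i0) = sym_of (l i0) (u i0)"
    using str_le_string_ofD[OF h le, of i0] i0 by simp
  then show "l' i0 = u' i0" "even (l i0 - l' i0)" using i0 by (auto simp: sym_of_def split: if_splits)
qed

lemma str_le_refl: "str_le s s"
  by (simp add: str_le_def)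

text \<open>After an even shift the pairs agree at a common bit, and nesting applies. Equal symbols
  mean intervals of equal length 0 or 1, so nested intervals coincide.\<close>

lemma heights_unique:
  assumes h: "heights l u" "heights l' u'" and eq: "string_of l' u' = string_of l u"
  shows "\<exists>k. even k \<and> (\<forall>i. l' i = l i + k \<and> u' i = u i + k)"
proof -
  have le: "str_le (string_of l' u') (string_of l u)" using eq str_le_refl by simp
  obtain i0 where i0: "l i0 = u i0" using heights_bit[OF h(1)] by blast
  define k where "k = l' i0 - l i0"
  have k: "even k" and bit: "l' i0 = u' i0"
    using heights_normalize[OF h le i0] by (auto simp: k_def)
  have hs: "heights (\<lambda>i. l i + k) (\<lambda>i. u i + k)" and ss: "string_of (\<lambda>i. l i + k) (\<lambda>i. u i + k) = string_of l u"
    using heights_shift[OF h(1) k] by auto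
  have le': "str_le (string_of l' u') (string_of (\<lambda>i. l i + k) (\<lambda>i. u i + k))"
    unfolding ss by (rule le)
  have n: "l i + k \<le> l' i" "u' i \<le> u i + k" for i
    by (rule heights_nested[OF hs h(2) le', of i0]; use i0 bit in \<open>simp add: k_def\<close>)+
  have "l' i = l i + k \<and> u' i = u i + k" for i
  proof -
    have "sym_of (l' i) (u' i) = sym_of (l i) (u i)"
      using cyc_string_of[OF h(1), of i] cyc_string_of[OF h(2), of i] eq by simp
    then have "l' i = u' i \<longleftrightarrow> l i = u i" by (auto simp: sym_of_def split: if_splits)
    then show ?thesis
      using n[of i] stepsD(1,5)[OF heights_steps[OF h(1)], of i] stepsD(1,5)[OF heights_steps[OF h(2)], of i]
      by linarith
  qed
  then show ?thesis using k by blast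
qed

definition liftings :: "sym list set \<Rightarrow> (sym list \<Rightarrow> nat \<Rightarrow> int) \<Rightarrow> (sym list \<Rightarrow> nat \<Rightarrow> int) \<Rightarrow> bool" where
  "liftings C lo hi \<longleftrightarrow> (\<forall>s\<in>C. heights (lo s) (hi s) \<and> string_of (lo s) (hi s) = s) \<and>
     (\<forall>s\<in>C. \<forall>s'\<in>C. str_le s s' \<longrightarrow> (\<forall>i. lo s' i \<le> lo s i \<and> hi s i \<le> hi s' i))"

lemma liftings_subset: "liftings C lo hi \<Longrightarrow> C' \<subseteq> C \<Longrightarrow> liftings C' lo hi"
  unfolding liftings_def by blast

lemma str_le_trans: "str_le a b \<Longrightarrow> str_le b c \<Longrightarrow> str_le a c"
  unfolding str_le_def is_bit_def by (metis (no_types))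

lemma str_le_antisym: "str_le a b \<Longrightarrow> str_le b a \<Longrightarrow> a = b"
  unfolding str_le_def is_bit_def by (intro nth_equalityI; metis (no_types))

text \<open>Single lifts are free up to an even shift; a lifting ties these shifts together. A bit
  of the coarsest string is shared by the whole chain, so all lifts can be given the same height
  there and are then nested.\<close>

lemma liftings_exist:
  assumes C: "C \<subseteq> Str N M" "is_chain str_le C" "finite C"
  shows "\<exists>lo hi. liftings C lo hi"
proof (cases "C = {}")
  case True
  then show ?thesis by (simp add: liftings_def)
next
  case False
  then obtain g where g: "g \<in> C" "\<And>s. s \<in> C \<Longrightarrow> str_le s g"
    using finite_total_greatest[of C str_le] C str_le_trans unfolding is_chain_def by blast
  obtain l u where lu: "heights l u" "string_of l u = g" using heights_exist g(1) C(1) by blast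
  obtain i0 where i0: "l i0 = u i0" using heights_bit[OF lu(1)] by blast
  have "\<exists>h. heights (fst h) (snd h) \<and> string_of (fst h) (snd h) = s \<and> fst h i0 = l i0 \<and> snd h i0 = l i0"
    if s: "s \<in> C" for s
  proof -
    obtain l' u' where lu': "heights l' u'" "string_of l' u' = s" using heights_exist s C(1) by blast
    define k where "k = l i0 - l' i0"
    have k: "even k" "l' i0 = u' i0"
      using heights_normalize[OF lu(1) lu'(1) _ i0] g(2)[OF s] lu lu' by (auto simp: k_def)
    have "heights (\<lambda>i. l' i + k) (\<lambda>i. u' i + k) \<and> string_of (\<lambda>i. l' i + k) (\<lambda>i. u' i + k) = s"
      using heights_shift[OF lu'(1) k(1)] lu'(2) by simp
    moreover have "l' i0 + k = l i0 \<and> u' i0 + k = l i0" using k(2) by (simp add: k_def)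
    ultimately show ?thesis
      by (intro exI[of _ "(\<lambda>i. l' i + k, \<lambda>i. u' i + k)"]) simp
  qed
  then obtain h where h: "\<And>s. s \<in> C \<Longrightarrow> heights (fst (h s)) (snd (h s)) \<and> string_of (fst (h s)) (snd (h s)) = s
      \<and> fst (h s) i0 = l i0 \<and> snd (h s) i0 = l i0" by metis
  have "liftings C (\<lambda>s. fst (h s)) (\<lambda>s. snd (h s))"
    unfolding liftings_def
  proof (intro conjI ballI impI allI)
    fix s s' i assume s: "s \<in> C" "s' \<in> C" "str_le s s'"
    show "fst (h s') i \<le> fst (h s) i" "snd (h s) i \<le> snd (h s') i"
      by (rule heights_nested[of "fst (h s')" "snd (h s')" "fst (h s)" "snd (h s)" i0 i];
          use h[OF s(1)] h[OF s(2)] s(3) in simp)+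
  qed (use h in auto)
  then show ?thesis by blast
qed

text \<open>At a bit of the coarsest string \<open>g\<close> all intervals of the chain collapse to
  one point, in both liftings, so every string is shifted by the same amount as
  \<open>g\<close>.\<close>

lemma liftings_unique:
  assumes C: "is_chain str_le C" "finite C"
    and L: "liftings C lo hi" and L': "liftings C lo' hi'"
  shows "\<exists>k. even k \<and> (\<forall>s\<in>C. \<forall>i. lo' s i = lo s i + k \<and> hi' s i = hi s i + k)"
proof (cases "C = {}")
  case True
  then show ?thesis by (intro exI[of _ 0]) simp
next
  case False
  then obtain g where g: "g \<in> C" "\<And>s. s \<in> C \<Longrightarrow> str_le s g"
    using finite_total_greatest[of C str_le] C str_le_trans unfolding is_chain_def by blast
  have uniq: "\<exists>k. even k \<and> (\<forall>i. lo' s i = lo s i + k \<and> hi' s i = hi s i + k)" if "s \<in> C" for s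
    using heights_unique[of "lo s" "hi s" "lo' s" "hi' s"] L L' that unfolding liftings_def by simp
  obtain k where k: "even k" "\<And>i. lo' g i = lo g i + k \<and> hi' g i = hi g i + k" using uniq[OF g(1)] by blast
  obtain i0 where i0: "lo g i0 = hi g i0" using heights_bit L g(1) unfolding liftings_def by blast
  have "lo' s i = lo s i + k \<and> hi' s i = hi s i + k" if s: "s \<in> C" for s i
  proof -
    obtain k' where k': "\<And>i. lo' s i = lo s i + k' \<and> hi' s i = hi s i + k'" using uniq[OF s] by blast
    have "heights (lo s) (hi s)" "heights (lo' s) (hi' s)" using L L' s unfolding liftings_def by auto
    then have "lo s i0 \<le> hi s i0" "lo' s i0 \<le> hi' s i0" using stepsD(1) heights_steps by blast+
    moreover have "lo g i0 \<le> lo s i0" "hi s i0 \<le> hi g i0" "lo' g i0 \<le> lo' s i0" "hi' s i0 \<le> hi' g i0"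
      using L L' g s unfolding liftings_def by blast+
    ultimately have "k' = k" using k(2)[of i0] k'[of i0] i0 by linarith
    then show ?thesis using k' by simp
  qed
  then show ?thesis using k(1) by blast
qed

end

section \<open>The homotopy to the circle\<close>

text \<open>The segment from \<open>f z\<close> to \<open>z\<close> misses 0, so the straight-line
  homotopy lives in the punctured plane and is pushed back radially.\<close>

lemma homotopic_id_of_not_antipodal:
  fixes f :: "complex \<Rightarrow> complex"
  assumes f: "continuous_on (sphere 0 1) f" "f \<in> sphere 0 1 \<rightarrow> sphere 0 1"
    and na: "\<And>z. z \<in> sphere 0 1 \<Longrightarrow> f z \<noteq> - z"
  shows "homotopic_with_canon (\<lambda>x. True) (sphere 0 1) (sphere 0 1) f id"
proof -
  have lin: "homotopic_with_canon (\<lambda>x. True) (sphere 0 1) (- {0}) f id"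
  proof (rule homotopic_with_linear[OF f(1) continuous_on_id'])
    fix z :: complex assume z: "z \<in> sphere 0 1"
    have "0 \<notin> closed_segment (f z) z"
    proof
      assume "0 \<in> closed_segment (f z) z"
      then obtain a where a: "0 \<le> a" "a \<le> 1" "0 = (1 - a) *\<^sub>R f z + a *\<^sub>R z"
        by (auto simp: closed_segment_def)
      then have eq: "(1 - a) *\<^sub>R f z = - (a *\<^sub>R z)" by (simp add: eq_neg_iff_add_eq_0)
      then have "norm ((1 - a) *\<^sub>R f z) = norm (a *\<^sub>R z)" by simp
      moreover have "norm (f z) = 1" "norm z = 1" using z f(2) by auto
      ultimately have "a = 1 / 2" using a by simp
      then have "2 * (1 - a) = 1" "2 * a = 1" by simp_all
      then have "f z = 2 *\<^sub>R ((1 - a) *\<^sub>R f z)" by (simp only: scaleR_scaleR scaleR_one)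
      also have "\<dots> = - z"
        unfolding eq using \<open>2 * a = 1\<close> by (simp only: scaleR_minus_right scaleR_scaleR scaleR_one)
      finally have "f z = - z" .
      then show False using na z by blast
    qed
    then show "closed_segment (f z) (id z) \<subseteq> - {0}" by auto
  qed
  have "homotopic_with_canon (\<lambda>x. True) (sphere 0 1) (sphere 0 1)
      ((\<lambda>z. z /\<^sub>R norm z) \<circ> f) ((\<lambda>z. z /\<^sub>R norm z) \<circ> id)"
    by (rule homotopic_with_compose_continuous_left[OF lin]) (auto intro!: continuous_intros)
  then show ?thesis
    by (rule homotopic_with_eq) (use f(2) in \<open>auto simp: Pi_iff\<close>)
qed

lemma cis_eq_imp: "cis a = cis b \<Longrightarrow> \<exists>k::int. a = b + 2 * pi * of_int k"
  using sin_cos_eq_iff[of a b] by (auto simp: complex_eq_iff)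

text \<open>With countably many strings the product space of real functions on them is metrizable,
  so continuity can be tested on sequences.\<close>

instance sym :: countable
  by countable_datatype

lemma finite_sym: "finite (UNIV :: sym set)"
proof -
  have "(UNIV :: sym set) = {S0, S1, SX}" using sym.exhaust by auto
  then show ?thesis by (metis finite.emptyI finite.insertI)
qed

context cellular_strings
begin

lemma finite_Str: "finite (Str N M)"
  by (rule finite_subset[OF _ finite_lists_length_eq[OF finite_sym, of N]]) (auto simp: Str_def)

sublocale finite_poset "Str N M" str_le
  by unfold_locales (fact finite_Str str_le_refl str_le_trans str_le_antisym)+

lemma string_of_mono:
  assumes "steps l u" "steps l' u'" "\<And>i. l' i \<le> l i" "\<And>i. u i \<le> u' i"
  shows "str_le (string_of l u) (string_of l' u')"
proof -
  have "sym_of (l i) (u i) = sym_of (l' i) (u' i) \<or>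
      sym_of (l' i) (u' i) = SX \<and> is_bit (sym_of (l i) (u i))" for i
  proof (cases "l' i = u' i")
    case True
    then have "l i = l' i" "u i = u' i"
      using stepsD(1)[OF assms(1), of i] assms(3,4)[of i] by linarith+
    then show ?thesis by simp
  next
    case False
    then show ?thesis by (simp add: sym_of_def is_bit_def)
  qed
  then show ?thesis by (simp add: str_le_def)
qed

section \<open>Rounding real heights\<close>

definition real_heights :: "(nat \<Rightarrow> real) \<Rightarrow> (nat \<Rightarrow> real) \<Rightarrow> bool" where
  "real_heights f g \<longleftrightarrow> (\<forall>i. f i \<le> g i \<and> f i \<le> f (Suc i) \<and> g i \<le> g (Suc i) \<and> g (Suc i) \<le> f i + 1 \<and>
     f (i + N) = f i + 2 * real M \<and> g (i + N) = g i + 2 * real M)"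

text \<open>Rounding to the nearest integer rather than down keeps integer heights away from the
  discontinuities; this gives continuity at \<open>q = 0\<close>.\<close>

definition rnd :: "(nat \<Rightarrow> real) \<Rightarrow> nat \<Rightarrow> int" where
  "rnd f i = \<lfloor>1 / 2 + f i\<rfloor>"

text \<open>The floor is monotone and commutes with integer shifts, and all the conditions are of
  these two kinds.\<close>

lemma heights_rnd:
  assumes "real_heights f g"
  shows "heights (rnd f) (rnd g)"
proof -
  have fg: "f i \<le> g i" "f i \<le> f (Suc i)" "g i \<le> g (Suc i)" "g (Suc i) \<le> f i + 1"
     "f (i + N) = f i + 2 * real M" "g (i + N) = g i + 2 * real M" for i
    using assms unfolding real_heights_def by auto
  have add: "\<lfloor>1 / 2 + (x + 2 * real M)\<rfloor> = \<lfloor>1 / 2 + x\<rfloor> + 2 * int M" for x :: real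
    by linarith
  have one: "\<lfloor>1 / 2 + x\<rfloor> \<le> \<lfloor>1 / 2 + y\<rfloor> + 1" if "x \<le> y + 1" for x y :: real
    using that by linarith
  show ?thesis
    unfolding heights_def steps_def rnd_def fg(5,6) add
    using fg(1-4) one by (auto intro!: floor_mono)
qed

lemma real_heights_convex:
  assumes "heights l u" "real_heights f g" "0 \<le> q" "q \<le> 1"
  shows "real_heights (\<lambda>i. (1 - q) * of_int (l i) + q * f i) (\<lambda>i. (1 - q) * of_int (u i) + q * g i)"
  unfolding real_heights_def
proof (intro allI conjI)
  fix i
  have lu: "real_of_int (l i) \<le> of_int (u i)" "real_of_int (l i) \<le> of_int (l (Suc i))"
    "real_of_int (u i) \<le> of_int (u (Suc i))" "real_of_int (u (Suc i)) \<le> of_int (l i) + 1"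
    using stepsD[OF heights_steps[OF assms(1)], of i] by linarith+
  have per: "real_of_int (l (i + N)) = of_int (l i) + 2 * real M"
    "real_of_int (u (i + N)) = of_int (u i) + 2 * real M"
    using assms(1) by (simp_all add: heights_def)
  have fg: "f i \<le> g i" "f i \<le> f (Suc i)" "g i \<le> g (Suc i)" "g (Suc i) \<le> f i + 1"
     "f (i + N) = f i + 2 * real M" "g (i + N) = g i + 2 * real M"
    using assms(2) unfolding real_heights_def by auto
  have cvx: "(1 - q) * a + q * b \<le> (1 - q) * a' + q * b'" if "a \<le> a'" "b \<le> b'" for a b a' b' :: real
    using that assms(3,4) by (intro add_mono mult_left_mono) auto
  show "(1 - q) * of_int (l i) + q * f i \<le> (1 - q) * of_int (u i) + q * g i"
    "(1 - q) * of_int (l i) + q * f i \<le> (1 - q) * of_int (l (Suc i)) + q * f (Suc i)"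
    "(1 - q) * of_int (u i) + q * g i \<le> (1 - q) * of_int (u (Suc i)) + q * g (Suc i)"
    using cvx lu fg by blast+
  show "(1 - q) * of_int (u (Suc i)) + q * g (Suc i) \<le> (1 - q) * of_int (l i) + q * f i + 1"
    using cvx[OF lu(4) fg(4)] by (simp add: algebra_simps)
  show "(1 - q) * of_int (l (i + N)) + q * f (i + N) = (1 - q) * of_int (l i) + q * f i + 2 * real M"
    "(1 - q) * of_int (u (i + N)) + q * g (i + N) = (1 - q) * of_int (u i) + q * g i + 2 * real M"
    unfolding per fg by (simp_all add: algebra_simps)
qed

definition slope :: real where
  "slope = 2 * real M / real N"

text \<open>The largest constant for which lines opened by \<open>slack * t\<close> up and down
  satisfy \<open>slope + 2 * slack * t \<le> 1\<close> up to \<open>t = 1\<close>. It is positive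
  because \<open>2 * M < N\<close>.\<close>

definition slack :: real where
  "slack = (1 - slope) / 2"

lemma slack_pos: "0 < slack" and slope_pos: "0 < slope"
proof -
  have "2 * real M < real N" using M_less by linarith
  then have "slope < 1" using N_pos by (simp add: slope_def)
  moreover show "0 < slope" using M_pos N_pos by (simp add: slope_def)
  ultimately show "0 < slack" by (simp add: slack_def)
qed

definition line :: "real \<Rightarrow> real \<Rightarrow> nat \<Rightarrow> real" where
  "line a t i = a + real i * slope + slack * t"

lemma line_mono: "t \<le> t' \<Longrightarrow> line a t i \<le> line a t' i"
  using slack_pos by (simp add: line_def)

lemma real_heights_line:
  assumes "0 \<le> t" "t \<le> 1"
  shows "real_heights (line a (- t)) (line a t)"
proof -
  have "slope + 2 * (slack * t) \<le> 1"
  proof -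
    have "slack * t \<le> slack" using assms slack_pos by (simp add: mult_left_le)
    then show ?thesis by (simp add: slack_def)
  qed
  moreover have "real N * slope = 2 * real M" using N_pos by (simp add: slope_def)
  ultimately show ?thesis
    using slope_pos slack_pos assms by (auto simp: real_heights_def line_def algebra_simps)
qed

definition interp :: "real \<Rightarrow> real \<Rightarrow> (nat \<Rightarrow> int) \<Rightarrow> real \<Rightarrow> nat \<Rightarrow> real" where
  "interp q a l t i = (1 - q) * of_int (l i) + q * line a t i"

text \<open>Rounding the interpolated heights. The slack lets the lower and the upper line drift apart with
  \<open>t\<close>; this makes all heights strictly monotone in \<open>t\<close> when \<open>q > 0\<close>, so the rounded string jumps at
  countably many \<open>t\<close> only, and its law depends continuously on \<open>q\<close> and \<open>a\<close>.\<close>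

definition moved :: "real \<Rightarrow> real \<Rightarrow> (nat \<Rightarrow> int) \<Rightarrow> (nat \<Rightarrow> int) \<Rightarrow> real \<Rightarrow> sym list" where
  "moved q a l u t = string_of (rnd (interp q a l (- t))) (rnd (interp q a u t))"

lemma heights_moved:
  assumes "q = 1 \<or> heights l u" "0 \<le> q" "q \<le> 1" "0 \<le> t" "t \<le> 1"
  shows "heights (rnd (interp q a l (- t))) (rnd (interp q a u t))"
proof (rule heights_rnd)
  have line: "real_heights (line a (- t)) (line a t)" using assms by (intro real_heights_line)
  show "real_heights (interp q a l (- t)) (interp q a u t)"
  proof (cases "q = 1")
    case True
    then have "interp q a l (- t) = line a (- t)" "interp q a u t = line a t"
      by (auto simp: interp_def)
    then show ?thesis using line by simp
  next
    case False
    have "interp q a l (- t) = (\<lambda>i. (1 - q) * of_int (l i) + q * line a (- t) i)"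
      "interp q a u t = (\<lambda>i. (1 - q) * of_int (u i) + q * line a t i)"
      by (auto simp: interp_def)
    then show ?thesis using real_heights_convex[OF _ line, of l u q] False assms by simp
  qed
qed

lemma interp_mono:
  assumes "q = 1 \<or> l i \<le> l' i" "0 \<le> q" "q \<le> 1" "t \<le> t'"
  shows "interp q a l t i \<le> interp q a l' t' i"
  unfolding interp_def
proof (rule add_mono)
  show "(1 - q) * of_int (l i) \<le> (1 - q) * of_int (l' i)"
    using assms by (auto intro: mult_left_mono)
  show "q * line a t i \<le> q * line a t' i"
    using assms line_mono by (auto intro: mult_left_mono)
qed

text \<open>Both ingredients widen: the integer intervals by nesting, the lines because the lower
  one falls and the upper one rises with \<open>t\<close>.\<close>

lemma moved_mono:
  assumes "q = 1 \<or> heights l u \<and> heights l' u' \<and> (\<forall>i. l' i \<le> l i \<and> u i \<le> u' i)"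
    and q: "0 \<le> q" "q \<le> 1" and t: "0 \<le> t" "t \<le> t'" "t' \<le> 1"
  shows "rnd (interp q a l' (- t')) i \<le> rnd (interp q a l (- t)) i"
    "rnd (interp q a u t) i \<le> rnd (interp q a u' t') i"
    "str_le (moved q a l u t) (moved q a l' u' t')"
proof -
  show 1: "rnd (interp q a l' (- t')) i \<le> rnd (interp q a l (- t)) i" for i
    unfolding rnd_def using assms by (intro floor_mono add_left_mono interp_mono) auto
  show 2: "rnd (interp q a u t) i \<le> rnd (interp q a u' t') i" for i
    unfolding rnd_def using assms by (intro floor_mono add_left_mono interp_mono) auto
  have "heights (rnd (interp q a l (- t))) (rnd (interp q a u t))"
    "heights (rnd (interp q a l' (- t'))) (rnd (interp q a u' t'))"
    using assms by (auto intro!: heights_moved)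
  then show "str_le (moved q a l u t) (moved q a l' u' t')"
    unfolding moved_def using 1 2 by (intro string_of_mono heights_steps)
qed

lemma moved_in_Str:
  assumes "q = 1 \<or> heights l u" "0 \<le> q" "q \<le> 1" "0 \<le> t" "t \<le> 1"
  shows "moved q a l u t \<in> Str N M"
  unfolding moved_def using heights_moved[OF assms] by (rule string_of_in_Str)

lemma rnd_interp_shift:
  assumes "\<And>i. l' i = l i + k"
  shows "rnd (interp q (a + of_int k) l' t) i = rnd (interp q a l t) i + k"
proof -
  have "1 / 2 + interp q (a + of_int k) l' t i = (1 / 2 + interp q a l t i) + of_int k"
    using assms by (simp add: interp_def line_def algebra_simps)
  then show ?thesis unfolding rnd_def by (simp only: floor_add_int[symmetric])
qed

lemma moved_shift:
  assumes "even k" "\<And>i. l' i = l i + k" "\<And>i. u' i = u i + k"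
  shows "moved q (a + of_int k) l' u' t = moved q a l u t"
  unfolding moved_def string_of_def
  using rnd_interp_shift[of l' l k q a] rnd_interp_shift[of u' u k q a] assms
  by (simp add: sym_of_shift)

lemma moved_0: "moved 0 a l u t = string_of l u"
proof -
  have "\<lfloor>1 / 2 + real_of_int z\<rfloor> = z" for z by linarith
  then show ?thesis unfolding moved_def string_of_def rnd_def interp_def by simp
qed

lemma moved_1: "moved 1 a l u t = moved 1 a l' u' t"
  unfolding moved_def string_of_def rnd_def interp_def by simp

definition jumps :: "real \<Rightarrow> real \<Rightarrow> (nat \<Rightarrow> int) \<Rightarrow> (nat \<Rightarrow> int) \<Rightarrow> real set" where
  "jumps q a l u = {t. \<exists>i. 1 / 2 + interp q a l (- t) i \<in> \<int> \<or> 1 / 2 + interp q a u t i \<in> \<int>}"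

lemma half_plus_int_notin_Ints: "1 / 2 + real_of_int z \<notin> \<int>"
proof
  assume "1 / 2 + real_of_int z \<in> \<int>"
  then obtain w where "1 / 2 + real_of_int z = of_int w" by (auto elim: Ints_cases)
  then have "real_of_int (2 * (w - z)) = real_of_int 1" by simp
  then have "2 * (w - z) = 1" by (simp only: of_int_eq_iff)
  then show False by presburger
qed

text \<open>For \<open>q \<noteq> 0\<close> each height is affine in \<open>t\<close> with slope
  \<open>q * slack\<close> up to sign, so it meets the integers countably often. For
  \<open>q = 0\<close> it is an integer, and adding 1/2 avoids the integers.\<close>

lemma countable_jumps: "countable (jumps q a l u)"
proof (cases "q = 0")
  case True
  then have "jumps q a l u = {}"
    using half_plus_int_notin_Ints by (auto simp: jumps_def interp_def)
  then show ?thesis by simp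
next
  case False
  have cnt: "countable {t. b + r * t \<in> (\<int>::real set)}" if "r \<noteq> 0" for b r :: real
  proof -
    have "inj (\<lambda>t. b + r * t)" using that by (auto simp: inj_def)
    then have "countable ((\<lambda>t. b + r * t) -` \<int>)"
      by (meson countable_int countable_image_inj_eq countable_subset image_vimage_subset inj_on_subset subset_UNIV)
    then show ?thesis by (simp add: vimage_def)
  qed
  have "jumps q a l u = (\<Union>i. {t. (1 / 2 + (1 - q) * of_int (l i) + q * (a + real i * slope)) + (- q * slack) * t \<in> \<int>}
      \<union> {t. (1 / 2 + (1 - q) * of_int (u i) + q * (a + real i * slope)) + (q * slack) * t \<in> \<int>})"
    unfolding jumps_def interp_def line_def by (auto simp: algebra_simps)
  moreover have "countable \<dots>"
    by (intro countable_UN countable_Un cnt countableI_type) (use False slack_pos in auto)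
  ultimately show ?thesis by simp
qed

lemma moved_eventually_const:
  assumes q: "q \<longlonglongrightarrow> q'" and a: "a \<longlonglongrightarrow> a'" and t: "t \<notin> jumps q' a' l u"
  shows "\<forall>\<^sub>F n in sequentially. moved (q n) (a n) l u t = moved q' a' l u t"
proof -
  have lim: "(\<lambda>n. 1 / 2 + interp (q n) (a n) h s i) \<longlonglongrightarrow> 1 / 2 + interp q' a' h s i" for h s i
    unfolding interp_def line_def by (intro tendsto_intros q a)
  have "\<forall>\<^sub>F n in sequentially. rnd (interp (q n) (a n) l (- t)) i = rnd (interp q' a' l (- t)) i" for i
    unfolding rnd_def by (rule eventually_floor_eq[OF lim]) (use t in \<open>auto simp: jumps_def\<close>)
  moreover have "\<forall>\<^sub>F n in sequentially. rnd (interp (q n) (a n) u t) i = rnd (interp q' a' u t) i" for i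
    unfolding rnd_def by (rule eventually_floor_eq[OF lim]) (use t in \<open>auto simp: jumps_def\<close>)
  \<comment> \<open>Only the \<open>N\<close> positions of one period enter the string, so finitely
    many eventual statements are combined.\<close>
  ultimately have "\<forall>\<^sub>F n in sequentially. \<forall>i\<in>{0..<N}.
      rnd (interp (q n) (a n) l (- t)) i = rnd (interp q' a' l (- t)) i \<and>
      rnd (interp (q n) (a n) u t) i = rnd (interp q' a' u t) i"
    by (intro eventually_ball_finite ballI eventually_conj) auto
  then show ?thesis
    by eventually_elim (auto simp: moved_def string_of_def)
qed

section \<open>The flow for a fixed lifting\<close>

definition angle :: "(sym list \<Rightarrow> nat \<Rightarrow> int) \<Rightarrow> (sym list \<Rightarrow> nat \<Rightarrow> int) \<Rightarrow> (sym list \<Rightarrow> real) \<Rightarrow> real" where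
  "angle lo hi p = (\<Sum>s\<in>Str N M. p s * (real_of_int (lo s 0 + hi s 0) / 2))"

text \<open>The parameter \<open>t\<close> serves twice: it selects the random string and it opens
  the lines.\<close>

definition flow_path where
  "flow_path lo hi q p t = moved q (angle lo hi p) (lo (sel p t)) (hi (sel p t)) t"

definition flow where
  "flow lo hi q p = law (flow_path lo hi q p)"

lemma rising_flow_path:
  assumes L: "liftings {s. p s \<noteq> 0} lo hi" and p: "p \<in> R" and q: "q \<in> {0..1}"
  shows "rising (flow_path lo hi q p)"
  unfolding rising_def
proof (intro conjI ballI impI)
  fix t :: real assume t: "t \<in> {0..<1}"
  then have "heights (lo (sel p t)) (hi (sel p t))"
    using L sel_support[OF p t] unfolding liftings_def by blast
  then show "flow_path lo hi q p t \<in> Str N M"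
    unfolding flow_path_def using q t by (intro moved_in_Str) auto
next
  fix t t' :: real assume t: "t \<in> {0..<1}" "t' \<in> {0..<1}" "t \<le> t'"
  have s: "sel p t \<in> {s. p s \<noteq> 0}" "sel p t' \<in> {s. p s \<noteq> 0}" using sel_support[OF p] t by auto
  have "str_le (sel p t) (sel p t')" using rising_sel[OF p] t unfolding rising_def by blast
  then have "heights (lo (sel p t)) (hi (sel p t)) \<and> heights (lo (sel p t')) (hi (sel p t')) \<and>
      (\<forall>i. lo (sel p t') i \<le> lo (sel p t) i \<and> hi (sel p t) i \<le> hi (sel p t') i)"
    using L s unfolding liftings_def by blast
  then show "str_le (flow_path lo hi q p t) (flow_path lo hi q p t')"
    unfolding flow_path_def using q t by (intro moved_mono(3)) auto
qed

lemma flow_0: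
  assumes L: "liftings {s. p s \<noteq> 0} lo hi" and p: "p \<in> R"
  shows "flow lo hi 0 p = p"
proof -
  have "flow lo hi 0 p = law (sel p)"
    unfolding flow_def
  proof (rule law_cong)
    fix t :: real assume "t \<in> {0..<1}"
    then have "p (sel p t) \<noteq> 0" by (rule sel_support[OF p])
    then show "flow_path lo hi 0 p t = sel p t"
      using L unfolding flow_path_def moved_0 liftings_def by blast
  qed
  then show ?thesis using law_sel[OF p] by simp
qed

text \<open>The weights sum to 1, so the mean height moves with the lifting. Heights and lines then
  move together by \<open>k\<close>, and symbols see only parity.\<close>

lemma angle_flow_shift:
  assumes p: "p \<in> R" and k: "even k" and
    sh: "\<And>s i. p s \<noteq> 0 \<Longrightarrow> lo' s i = lo s i + k \<and> hi' s i = hi s i + k"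
  shows "angle lo' hi' p = angle lo hi p + of_int k" "flow lo' hi' q p = flow lo hi q p"
proof -
  have one: "sum p (Str N M) = 1" using p by (simp add: order_complex_realization_def)
  have "angle lo' hi' p = (\<Sum>s\<in>Str N M. p s * (real_of_int (lo s 0 + hi s 0) / 2) + p s * of_int k)"
    unfolding angle_def
  proof (rule sum.cong)
    fix s
    show "p s * (real_of_int (lo' s 0 + hi' s 0) / 2) = p s * (real_of_int (lo s 0 + hi s 0) / 2) + p s * of_int k"
      using sh[of s 0] by (cases "p s = 0") (simp_all add: field_simps)
  qed simp
  also have "\<dots> = angle lo hi p + sum p (Str N M) * of_int k"
    by (simp add: sum.distrib sum_distrib_right angle_def)
  finally show ang: "angle lo' hi' p = angle lo hi p + of_int k" using one by simp
  show "flow lo' hi' q p = flow lo hi q p"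
    unfolding flow_def
  proof (rule law_cong)
    fix t :: real assume "t \<in> {0..<1}"
    then have "p (sel p t) \<noteq> 0" by (rule sel_support[OF p])
    then show "flow_path lo' hi' q p t = flow_path lo hi q p t"
      unfolding flow_path_def ang using sh k by (intro moved_shift) auto
  qed
qed

text \<open>One lifting serves a whole face, so the mean height converges along sequences. Off a
  countable set of times both the selected string and its rounded image are eventually
  constant.\<close>

lemma flow_continuous:
  assumes C: "C \<in> chains" and L: "liftings C lo hi"
  shows "continuous_on ({0..1} \<times> face C) (\<lambda>(q, p). flow lo hi q p)"
proof (rule continuous_on_coordinatewise_then_product)
  fix x
  have inR: "p \<in> R" and Lp: "liftings {s. p s \<noteq> 0} lo hi" if "p \<in> face C" for p
  proof -
    show "p \<in> R" using that face_subset[OF C] by blast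
    have "{s. p s \<noteq> 0} \<subseteq> C" using that by (auto simp: face_def)
    then show "liftings {s. p s \<noteq> 0} lo hi" using L liftings_subset by blast
  qed
  show "continuous_on ({0..1} \<times> face C) (\<lambda>y. (case y of (q, p) \<Rightarrow> flow lo hi q p) x)"
    unfolding continuous_on_sequentially
  proof (intro allI ballI impI, elim conjE)
    fix y :: "nat \<Rightarrow> real \<times> (sym list \<Rightarrow> real)" and y'
    assume y': "y' \<in> {0..1} \<times> face C" and y: "\<forall>n. y n \<in> {0..1} \<times> face C" and lim: "y \<longlonglongrightarrow> y'"
    define q p where "q n = fst (y n)" and "p n = snd (y n)" for n
    define q' p' where "q' = fst y'" and "p' = snd y'"
    have mem: "q n \<in> {0..1}" "p n \<in> face C" "q' \<in> {0..1}" "p' \<in> face C" for n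
      using y y' by (auto simp: q_def p_def q'_def p'_def mem_Times_iff)
    have qlim: "q \<longlonglongrightarrow> q'" and pl: "p \<longlonglongrightarrow> p'"
      using tendsto_fst[OF lim] tendsto_snd[OF lim]
      unfolding q_def[abs_def] p_def[abs_def] q'_def p'_def by simp_all
    have plim: "(\<lambda>n. p n s) \<longlonglongrightarrow> p' s" for s
      by (rule continuous_on_tendsto_compose[OF continuous_on_product_coordinates pl]) simp_all
    have alim: "(\<lambda>n. angle lo hi (p n)) \<longlonglongrightarrow> angle lo hi p'"
      unfolding angle_def by (intro tendsto_intros plim)
    \<comment> \<open>Exceptional times: interval starts of the limit point, and jump times at the
      limit parameters of every string in the finite poset.\<close>
    define B where "B = weight_below p' ` Str N M \<union> (\<Union>s\<in>Str N M. jumps q' (angle lo hi p') (lo s) (hi s))"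
    have "countable B" unfolding B_def using finite_Str countable_jumps
      by (auto intro!: countable_Un countable_UN countable_finite)
    have "(\<lambda>n. law (flow_path lo hi (q n) (p n)) x) \<longlonglongrightarrow> law (flow_path lo hi q' p') x"
    proof (rule law_tendsto[OF _ _ \<open>countable B\<close>])
      show "rising (flow_path lo hi (q n) (p n))" for n
        using rising_flow_path[OF Lp inR] mem by blast
      show "rising (flow_path lo hi q' p')"
        using rising_flow_path[OF Lp inR] mem by blast
      fix t :: real assume t: "t \<in> {0..<1}" "t \<notin> B"
      define s where "s = sel p' t"
      have "s \<in> Str N M"
        using rising_sel[OF inR[OF mem(4)]] t(1) unfolding rising_def s_def by blast
      then have "t \<notin> jumps q' (angle lo hi p') (lo s) (hi s)" using t(2) by (auto simp: B_def)
      then have "\<forall>\<^sub>F n in sequentially. moved (q n) (angle lo hi (p n)) (lo s) (hi s) t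
          = moved q' (angle lo hi p') (lo s) (hi s) t"
        by (rule moved_eventually_const[OF qlim alim])
      moreover have "\<forall>\<^sub>F n in sequentially. sel (p n) t = s"
        unfolding s_def
        by (rule sel_eventually_const) (use inR mem plim t in \<open>auto simp: B_def\<close>)
      ultimately show "\<forall>\<^sub>F n in sequentially. flow_path lo hi (q n) (p n) t = flow_path lo hi q' p' t"
        by eventually_elim (simp add: flow_path_def s_def)
    qed
    then show "((\<lambda>y. (case y of (q, p) \<Rightarrow> flow lo hi q p) x) \<circ> y) \<longlonglongrightarrow> (case y' of (q, p) \<Rightarrow> flow lo hi q p) x"
      by (simp add: flow_def o_def case_prod_unfold q_def p_def q'_def p'_def)
  qed
qed

section \<open>Independence of the lifting and gluing over faces\<close>

definition lift_of where
  "lift_of p = (SOME h. liftings {s. p s \<noteq> 0} (fst h) (snd h))"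

definition homotopy where
  "homotopy q p = flow (fst (lift_of p)) (snd (lift_of p)) q p"

definition to_circle where
  "to_circle p = cis (pi * angle (fst (lift_of p)) (snd (lift_of p)) p)"

lemma liftings_lift_of:
  assumes "p \<in> R"
  shows "liftings {s. p s \<noteq> 0} (fst (lift_of p)) (snd (lift_of p))"
proof -
  have "\<exists>lo hi. liftings {s. p s \<noteq> 0} lo hi"
    using support_chain[OF assms] by (intro liftings_exist) (auto simp: chains_def intro: finite_subset[OF _ finite_Str])
  then have "\<exists>h. liftings {s. p s \<noteq> 0} (fst h) (snd h)" by simp
  then show ?thesis unfolding lift_of_def by (rule someI_ex)
qed

text \<open>The choice in \<open>lift_of\<close> is arbitrary, but two liftings of the support
  differ by one even shift. This leaves the flow unchanged and moves the angle by a period of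
  \<open>cis (pi * a)\<close>.\<close>

lemma lift_independent:
  assumes p: "p \<in> R" and L: "liftings {s. p s \<noteq> 0} lo hi"
  shows "homotopy q p = flow lo hi q p" "to_circle p = cis (pi * angle lo hi p)"
proof -
  have "is_chain str_le {s. p s \<noteq> 0}" "finite {s. p s \<noteq> 0}"
    using support_chain[OF p] by (auto simp: chains_def intro: finite_subset[OF _ finite_Str])
  then obtain k where k: "even k" "\<And>s i. p s \<noteq> 0 \<Longrightarrow>
      fst (lift_of p) s i = lo s i + k \<and> snd (lift_of p) s i = hi s i + k"
    using liftings_unique[OF _ _ L liftings_lift_of[OF p]] by blast
  have sh: "angle (fst (lift_of p)) (snd (lift_of p)) p = angle lo hi p + of_int k"
    "flow (fst (lift_of p)) (snd (lift_of p)) q p = flow lo hi q p" for q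
    using angle_flow_shift[OF p k(1)] k(2) by blast+
  show "homotopy q p = flow lo hi q p" unfolding homotopy_def by (rule sh(2))
  obtain j where j: "k = 2 * j" using k(1) by (elim evenE)
  have "cis (pi * (angle lo hi p + of_int k)) = cis (pi * angle lo hi p) * cis (2 * pi * of_int j)"
    by (simp add: cis_mult j algebra_simps)
  also have "cis (2 * pi * of_int j) = 1"
    by (metis cis_multiple_2pi Ints_of_int)
  finally show "to_circle p = cis (pi * angle lo hi p)" unfolding to_circle_def sh(1) by simp
qed

lemma face_liftings:
  assumes "C \<in> chains"
  obtains lo hi where "liftings C lo hi" "\<And>p. p \<in> face C \<Longrightarrow> p \<in> R \<and> liftings {s. p s \<noteq> 0} lo hi"
proof -
  have "C \<subseteq> Str N M" "is_chain str_le C" "finite C"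
    using assms by (auto simp: chains_def intro: finite_subset[OF _ finite_Str])
  then obtain lo hi where L: "liftings C lo hi" using liftings_exist by blast
  have "p \<in> R \<and> liftings {s. p s \<noteq> 0} lo hi" if "p \<in> face C" for p
  proof -
    have "{s. p s \<noteq> 0} \<subseteq> C" using that by (auto simp: face_def)
    then show ?thesis using L liftings_subset that face_subset[OF assms] by blast
  qed
  then show ?thesis using L that by blast
qed

text \<open>On each face the pointwise chosen liftings may be replaced by a single one; the finitely
  many closed pieces are then pasted.\<close>

lemma homotopy_continuous: "continuous_on ({0..1} \<times> R) (\<lambda>(q, p). homotopy q p)"
proof -
  have "continuous_on (\<Union>C\<in>chains. {0..1} \<times> face C) (\<lambda>(q, p). homotopy q p)"
  proof (rule continuous_on_closed_Union[OF finite_chains])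
    fix C assume C: "C \<in> chains"
    show "closed ({0..1::real} \<times> face C)" by (intro closed_Times closed_face) simp
    obtain lo hi where L: "liftings C lo hi" "\<And>p. p \<in> face C \<Longrightarrow> p \<in> R \<and> liftings {s. p s \<noteq> 0} lo hi"
      by (rule face_liftings[OF C]) (rule that)
    show "continuous_on ({0..1} \<times> face C) (\<lambda>(q, p). homotopy q p)"
      by (rule continuous_on_eq[OF flow_continuous[OF C L(1)]]) (use L(2) lift_independent(1) in force)
  qed
  moreover have "(\<Union>C\<in>chains. {0..1::real} \<times> face C) = {0..1} \<times> R"
    unfolding realization_eq_Union_faces by auto
  ultimately show ?thesis by simp
qed

lemma to_circle_continuous: "continuous_on R to_circle"
  unfolding realization_eq_Union_faces
proof (rule continuous_on_closed_Union[OF finite_chains closed_face])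
  fix C assume C: "C \<in> chains"
  obtain lo hi where L: "\<And>p. p \<in> face C \<Longrightarrow> p \<in> R \<and> liftings {s. p s \<noteq> 0} lo hi"
    by (rule face_liftings[OF C]) (rule that)
  have "continuous_on (face C) (\<lambda>p. p s)" for s
    by (rule continuous_on_subset[OF continuous_on_product_coordinates]) simp
  then have "continuous_on (face C) (\<lambda>p. cis (pi * angle lo hi p))"
    unfolding angle_def cis_conv_exp by (intro continuous_intros)
  then show "continuous_on (face C) to_circle"
    by (rule continuous_on_eq) (use L lift_independent(2) in force)
qed

section \<open>The loop of rounded lines\<close>

definition loop_path :: "real \<Rightarrow> real \<Rightarrow> sym list" where
  "loop_path a t = moved 1 a (\<lambda>_. 0) (\<lambda>_. 0) t"

definition loop :: "real \<Rightarrow> sym list \<Rightarrow> real" where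
  "loop a = law (loop_path a)"

lemma rising_loop_path: "rising (loop_path a)"
  unfolding rising_def loop_path_def by (auto intro!: moved_in_Str moved_mono(3))

lemma loop_in_R: "loop a \<in> R"
  unfolding loop_def by (rule law_in_realization[OF rising_loop_path])

text \<open>At \<open>q = 1\<close> the string is forgotten and only the angle survives, so the end
  of the homotopy factors through the circle.\<close>

lemma flow_1: "flow lo hi 1 p = loop (angle lo hi p)"
  unfolding flow_def loop_def
  by (rule law_cong) (simp add: flow_path_def loop_path_def moved_1[of _ "\<lambda>_. 0" "\<lambda>_. 0"] moved_1)

lemma loop_shift:
  assumes "even k"
  shows "loop (a + of_int k) = loop a"
proof -
  have "loop_path (a + of_int k) t = loop_path a t" for t
    unfolding loop_path_def
    using moved_shift[OF assms, of "\<lambda>_. 0 + k" "\<lambda>_. 0" "\<lambda>_. 0 + k" "\<lambda>_. 0" 1 a t]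
      moved_1[of "a + of_int k" "\<lambda>_. 0" "\<lambda>_. 0" t "\<lambda>_. 0 + k" "\<lambda>_. 0 + k"] by simp
  then have "loop_path (a + of_int k) = loop_path a" by blast
  then show ?thesis by (simp add: loop_def)
qed

lemma loop_eq_if_cis_eq:
  assumes "cis (pi * a) = cis (pi * b)"
  shows "loop a = loop b"
proof -
  obtain k :: int where "pi * a = pi * b + 2 * pi * of_int k" using cis_eq_imp[OF assms] by blast
  then have "pi * a = pi * (b + of_int (2 * k))" by (simp add: algebra_simps)
  then have "a = b + of_int (2 * k)" using pi_neq_zero by (metis mult_cancel_left)
  then show ?thesis using loop_shift[of "2 * k" b] by simp
qed

lemma loop_continuous: "continuous_on UNIV loop"
proof (rule continuous_on_coordinatewise_then_product)
  fix x
  show "continuous_on UNIV (\<lambda>a. loop a x)"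
    unfolding continuous_on_sequentially
  proof (intro allI ballI impI, elim conjE)
    fix a :: "nat \<Rightarrow> real" and a' assume lim: "a \<longlonglongrightarrow> a'"
    have "(\<lambda>n. law (loop_path (a n)) x) \<longlonglongrightarrow> law (loop_path a') x"
    proof (rule law_tendsto[OF rising_loop_path rising_loop_path countable_jumps])
      fix t assume "t \<notin> jumps 1 a' (\<lambda>_. 0) (\<lambda>_. 0)"
      then show "\<forall>\<^sub>F n in sequentially. loop_path (a n) t = loop_path a' t"
        unfolding loop_path_def by (rule moved_eventually_const[OF tendsto_const lim])
    qed
    then show "((\<lambda>a. loop a x) \<circ> a) \<longlonglongrightarrow> loop a' x" by (simp add: loop_def o_def)
  qed
qed

definition from_circle :: "complex \<Rightarrow> sym list \<Rightarrow> real" where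
  "from_circle z = loop (Arg z / pi)"

lemma cis_Arg_sphere: "z \<in> sphere 0 1 \<Longrightarrow> cis (Arg z) = z"
  using rcis_cmod_Arg[of z] by (simp add: rcis_def)

lemma from_circle_cis: "from_circle (cis (pi * a)) = loop a"
  unfolding from_circle_def
  by (rule loop_eq_if_cis_eq) (use cis_Arg_sphere[of "cis (pi * a)"] in simp)

text \<open>Off the cut of \<open>Arg\<close> this is composition. On the cut the branch
  \<open>1 + Arg (- z) / pi\<close> is continuous, and periodicity of \<open>loop\<close> makes both
  branches give the same value.\<close>

lemma from_circle_continuous: "continuous_on (sphere 0 1) from_circle"
  unfolding continuous_on_eq_continuous_within
proof
  fix z :: complex assume z: "z \<in> sphere 0 1"
  have isCont_loop: "isCont loop a" for a
    using loop_continuous by (simp add: continuous_on_eq_continuous_at)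
  show "continuous (at z within sphere 0 1) from_circle"
  proof (cases "z \<in> \<real>\<^sub>\<le>\<^sub>0")
    case False
    have "continuous (at z) (\<lambda>z. loop (Arg z / pi))"
      by (intro continuous_within_compose3[OF isCont_loop] continuous_intros continuous_at_Arg False) simp
    then show ?thesis unfolding from_circle_def by (rule continuous_at_imp_continuous_at_within)
  next
    case True
    have "z \<noteq> 0" using z by auto
    then have "- z \<notin> \<real>\<^sub>\<le>\<^sub>0"
      using True by (auto simp: complex_nonpos_Reals_iff complex_eq_iff)
    then have "continuous (at z) (\<lambda>z. Arg (- z))"
      using continuous_within_compose3[OF continuous_at_Arg, of uminus z UNIV] by (simp add: continuous_minus)
    then have "continuous (at z) (\<lambda>z. loop (1 + Arg (- z) / pi))"
      by (intro continuous_within_compose3[OF isCont_loop] continuous_intros) simp_all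
    then have c: "continuous (at z within sphere 0 1) (\<lambda>z. loop (1 + Arg (- z) / pi))"
      by (rule continuous_at_imp_continuous_at_within)
    have eq: "loop (1 + Arg (- w) / pi) = from_circle w" if "w \<in> sphere 0 1" for w
    proof -
      have "cis (pi * (1 + Arg (- w) / pi)) = cis pi * cis (Arg (- w))"
        unfolding cis_mult by (simp add: distrib_left)
      also have "\<dots> = w" using cis_Arg_sphere[of "- w"] that by simp
      finally show ?thesis using from_circle_cis by metis
    qed
    show ?thesis
      by (rule continuous_transform_within[OF c, of 1]) (use z eq in auto)
  qed
qed

text \<open>The rounded lines are themselves a lifting: each string of the support gets the heights
  at some time \<open>T s\<close> when the path passes it.\<close>

lemma loop_liftings:
  "\<exists>lo hi. liftings {s. loop a s \<noteq> 0} lo hi \<and>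
     (\<forall>s. loop a s \<noteq> 0 \<longrightarrow> \<bar>real_of_int (lo s 0 + hi s 0) / 2 - a\<bar> < 1)"
proof -
  define l u where "l t = rnd (interp 1 a (\<lambda>_. 0) (- t))" and "u t = rnd (interp 1 a (\<lambda>_. 0) t)" for t
  have path: "loop_path a t = string_of (l t) (u t)" for t
    by (simp add: loop_path_def moved_def l_def u_def)
  have "\<exists>t\<in>{0..<1}. loop_path a t = s" if "loop a s \<noteq> 0" for s
    using law_pos_attained that unfolding loop_def by blast
  then obtain T where T: "\<And>s. loop a s \<noteq> 0 \<Longrightarrow> T s \<in> {0..<1} \<and> loop_path a (T s) = s" by metis
  have h: "heights (l t) (u t)" if "t \<in> {0..<1}" for t
    unfolding l_def u_def using that by (intro heights_moved) auto
  have mono: "l t' i \<le> l t i \<and> u t i \<le> u t' i" if "t \<in> {0..<1}" "t' \<in> {0..<1}" "t \<le> t'" for t t' i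
    unfolding l_def u_def using that by (intro conjI moved_mono(1,2)) auto
  have "liftings {s. loop a s \<noteq> 0} (\<lambda>s. l (T s)) (\<lambda>s. u (T s))"
    unfolding liftings_def
  proof (intro conjI ballI impI allI)
    fix s s' i assume s: "s \<in> {s. loop a s \<noteq> 0}" "s' \<in> {s. loop a s \<noteq> 0}" "str_le s s'"
    have Ts: "T s \<in> {0..<1}" "loop_path a (T s) = s" "T s' \<in> {0..<1}" "loop_path a (T s') = s'"
      using s T by auto
    have "l (T s') i \<le> l (T s) i \<and> u (T s) i \<le> u (T s') i"
    proof (cases "T s \<le> T s'")
      case True
      then show ?thesis using mono Ts by blast
    next
      case False
      \<comment> \<open>If the chosen times are in the wrong order, monotonicity of the path gives
        the reverse comparison and the strings coincide.\<close>
      then have "str_le (loop_path a (T s')) (loop_path a (T s))"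
        using rising_loop_path[of a] Ts unfolding rising_def by (meson linear)
      then have "str_le s' s" unfolding Ts .
      then have "s = s'" using s(3) str_le_antisym by blast
      then show ?thesis by simp
    qed
    then show "l (T s') i \<le> l (T s) i" "u (T s) i \<le> u (T s') i" by auto
  next
    fix s assume "s \<in> {s. loop a s \<noteq> 0}"
    then have Ts: "T s \<in> {0..<1}" "loop_path a (T s) = s" using T by auto
    show "heights (l (T s)) (u (T s))" using h Ts by blast
    show "string_of (l (T s)) (u (T s)) = s" using path Ts by metis
  qed
  \<comment> \<open>The opening \<open>slack * t\<close> cancels in the midpoint, and each rounding
    errs by at most 1/2.\<close>
  moreover have "\<bar>real_of_int (l t 0 + u t 0) / 2 - a\<bar> < 1" for t
  proof -
    have l: "l t 0 = \<lfloor>1 / 2 + (a - slack * t)\<rfloor>" and u: "u t 0 = \<lfloor>1 / 2 + (a + slack * t)\<rfloor>"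
      by (simp_all add: l_def u_def rnd_def interp_def line_def)
    have "of_int (l t 0) \<le> 1 / 2 + (a - slack * t)" "1 / 2 + (a - slack * t) < of_int (l t 0) + 1"
      "of_int (u t 0) \<le> 1 / 2 + (a + slack * t)" "1 / 2 + (a + slack * t) < of_int (u t 0) + 1"
      unfolding l u using floor_correct[of "1 / 2 + (a - slack * t)"] floor_correct[of "1 / 2 + (a + slack * t)"]
      by simp_all
    moreover have "\<bar>(x + y) / 2 - a\<bar> < 1" if "x \<le> 1 / 2 + (a - e)" "1 / 2 + (a - e) < x + 1"
      "y \<le> 1 / 2 + (a + e)" "1 / 2 + (a + e) < y + 1" for x y e :: real
      using that by (simp add: abs_less_iff field_simps)
    ultimately show ?thesis unfolding of_int_add by blast
  qed
  ultimately show ?thesis using T by blast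
qed

text \<open>The mean height is an average of values within distance less than 1 of \<open>a\<close>,
  while an antipodal value would put it at an odd integer distance.\<close>

lemma to_circle_loop: "to_circle (loop a) \<noteq> - cis (pi * a)"
proof
  assume eq: "to_circle (loop a) = - cis (pi * a)"
  obtain lo hi where L: "liftings {s. loop a s \<noteq> 0} lo hi"
    and near: "\<And>s. loop a s \<noteq> 0 \<Longrightarrow> \<bar>real_of_int (lo s 0 + hi s 0) / 2 - a\<bar> < 1"
    using loop_liftings[of a] by blast
  define b where "b = angle lo hi (loop a)"
  have p: "\<And>s. 0 \<le> loop a s" "sum (loop a) (Str N M) = 1"
    using loop_in_R[of a] by (auto simp: order_complex_realization_def)
  have "b - a = (\<Sum>s\<in>Str N M. loop a s * (real_of_int (lo s 0 + hi s 0) / 2 - a))"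
    using p(2) by (simp add: b_def angle_def right_diff_distrib sum_subtractf flip: sum_distrib_right)
  also have "\<bar>\<dots>\<bar> < (\<Sum>s\<in>Str N M. loop a s * 1)"
  proof -
    have le: "\<bar>loop a s * (real_of_int (lo s 0 + hi s 0) / 2 - a)\<bar> \<le> loop a s * 1" for s
      using near[of s] p(1)[of s] by (cases "loop a s = 0") (auto simp: abs_mult)
    \<comment> \<open>Some weight is nonzero, which makes the estimate of the sum strict.\<close>
    obtain s where s: "s \<in> Str N M" "loop a s \<noteq> 0"
      using p(2) by (metis sum.neutral zero_neq_one)
    have "\<bar>\<Sum>s\<in>Str N M. loop a s * (real_of_int (lo s 0 + hi s 0) / 2 - a)\<bar>
        \<le> (\<Sum>s\<in>Str N M. \<bar>loop a s * (real_of_int (lo s 0 + hi s 0) / 2 - a)\<bar>)"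
      by (rule sum_abs)
    also have "\<dots> < (\<Sum>s\<in>Str N M. loop a s * 1)"
    proof (rule sum_strict_mono_ex1[OF finite_Str])
      have "\<bar>loop a s * (real_of_int (lo s 0 + hi s 0) / 2 - a)\<bar> < loop a s * 1"
        using near[OF s(2)] p(1)[of s] s(2) unfolding abs_mult
        by simp
      then show "\<exists>s\<in>Str N M. \<bar>loop a s * (real_of_int (lo s 0 + hi s 0) / 2 - a)\<bar> < loop a s * 1"
        using s(1) by blast
    qed (use le in blast)
    finally show ?thesis .
  qed
  finally have less: "\<bar>b - a\<bar> < 1" using p(2) by simp
  have "cis (pi * b) = - cis (pi * a)"
    using eq lift_independent(2)[OF loop_in_R L] by (simp add: b_def)
  also have "\<dots> = cis (pi * (a + 1))" by (simp add: distrib_left flip: cis_mult)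
  finally obtain k :: int where "pi * b = pi * (a + 1) + 2 * pi * of_int k" using cis_eq_imp by blast
  then have "pi * b = pi * (a + 1 + 2 * of_int k)" by (simp add: algebra_simps)
  then have "b - a = 1 + 2 * of_int k" using pi_neq_zero by (simp only: mult_cancel_left) simp
  then have "\<bar>real_of_int (1 + 2 * k)\<bar> < real_of_int 1" using less by simp
  then have "\<bar>1 + 2 * k\<bar> < 1" by linarith
  then show False by presburger
qed

section \<open>The two composites and their homotopies to the identity\<close>

theorem realization_homotopy_equivalent_circle:
  "geom_realization (Str N M) str_le homotopy_equivalent_space top_of_set (sphere (0::complex) 1)"
  unfolding geom_realization_eq homotopy_equivalent_space_def
proof (intro exI conjI)
  show "continuous_map (top_of_set R) (top_of_set (sphere 0 1)) to_circle"
    using to_circle_continuous by (auto simp: continuous_map_subtopology_eu to_circle_def)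
  show "continuous_map (top_of_set (sphere 0 1)) (top_of_set R) from_circle"
    using from_circle_continuous loop_in_R by (auto simp: continuous_map_subtopology_eu from_circle_def)
  have end1: "homotopy 1 p = from_circle (to_circle p)" for p
    unfolding homotopy_def to_circle_def flow_1 from_circle_cis ..
  have "homotopic_with_canon (\<lambda>x. True) R R id (from_circle \<circ> to_circle)"
  proof (subst homotopic_with)
    have "homotopy q p \<in> R" if "p \<in> R" "q \<in> {0..1}" for q p
      unfolding homotopy_def flow_def
      using law_in_realization[OF rising_flow_path[OF liftings_lift_of]] that by blast
    then have "continuous_map (prod_topology (top_of_set {0..1}) (top_of_set R)) (top_of_set R) (\<lambda>(q, p). homotopy q p)"
      using homotopy_continuous by (auto simp: continuous_map_subtopology_eu)
    moreover have "homotopy 0 p = p" if "p \<in> R" for p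
      unfolding homotopy_def using flow_0[OF liftings_lift_of] that by blast
    ultimately show "\<exists>h. continuous_map (prod_topology (top_of_set {0..1::real}) (top_of_set R)) (top_of_set R) h \<and>
        (\<forall>x\<in>topspace (top_of_set R). h (0, x) = id x) \<and>
        (\<forall>x\<in>topspace (top_of_set R). h (1, x) = (from_circle \<circ> to_circle) x) \<and> (\<forall>t\<in>{0..1::real}. True)"
      using end1 by (intro exI[of _ "\<lambda>(q, p). homotopy q p"]) auto
  qed simp
  then show "homotopic_with_canon (\<lambda>x. True) R R (from_circle \<circ> to_circle) id"
    by (rule homotopic_with_symD)
  show "homotopic_with_canon (\<lambda>x. True) (sphere 0 1) (sphere 0 1) (to_circle \<circ> from_circle) id"
  proof (rule homotopic_id_of_not_antipodal)
    have "from_circle ` sphere 0 1 \<subseteq> R" using loop_in_R by (auto simp: from_circle_def)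
    then show "continuous_on (sphere 0 1) (to_circle \<circ> from_circle)"
      using from_circle_continuous to_circle_continuous continuous_on_subset by (intro continuous_on_compose) blast+
    show "to_circle \<circ> from_circle \<in> sphere 0 1 \<rightarrow> sphere 0 1" by (auto simp: to_circle_def)
    fix z :: complex assume z: "z \<in> sphere 0 1"
    show "(to_circle \<circ> from_circle) z \<noteq> - z"
      using to_circle_loop[of "Arg z / pi"] cis_Arg_sphere[OF z] by (simp add: from_circle_def)
  qed
qed

end

theorem theorem6p2:
  fixes N M :: nat
  assumes "0 < M" and "2 * M < N"
  shows "geom_realization (Str N M) str_le homotopy_equivalent_space
           top_of_set (sphere (0::complex) 1)"
proof -
  interpret cellular_strings N M by unfold_locales (fact assms)+
  show ?thesis by (rule realization_homotopy_equivalent_circle)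
qed

end
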